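(* Let $\alpha\in(0,1)$ be an irrational number which is not of bounded type. There are values of the parameters $\beta,\gamma,\delta\in[0,1)$ for which the cocycle $\Psi_4:\mathbb T\to\mathbb R^4$, $\Psi_4(x)=(\psi(x),\psi(x+\beta),\psi(x+\gamma),\psi(x+\delta))$ with $\psi(x)=\{x\}-\frac12$, is not regular over the rotation $Tx=x+\alpha$.
   Context: $\mathbb T=[0,1)$ is the additive circle (addition mod $1$) with Lebesgue measure $\mu$; $\{x\}$ is the fractional part. An irrational $\alpha=[0;a_1,a_2,\dots]$ is of bounded type if its sequence of partial quotients $(a_n)$ is bounded. A measurable function $\Phi:\mathbb T\to\mathbb R^m$ is called a cocycle over $T$. Two cocycles $\Phi,\Psi:\mathbb T\to\mathbb R^m$ are cohomologous if $\Phi-\Psi=f-f\circ T$ a.e. for some measurable $f:\mathbb T\to\mathbb R^m$. A cocycle $\Phi:\mathbb T\to\mathbb R^m$ is regular if it is cohomologous to a cocycle $\Psi$ taking values in a closed subgroup $H\subset\mathbb R^m$ such that $T_\Psi(x,h)=(Tx,h+\Psi(x))$ is ergodic on $\mathbb T\times H$ for the product of $\mu$ and Haar measure on $H$. *)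

theory Defs
  imports "HOL-Analysis.Analysis"
begin

section \<open>Continued fractions\<close>

definition gauss_map :: "real \<Rightarrow> real" where
  "gauss_map x = frac (1 / x)"

text \<open>For irrational \<open>\<alpha>\<close> in \<open>(0,1)\<close>, \<open>\<alpha> = [0; a\<^sub>1, a\<^sub>2, \<dots>]\<close> with
  \<open>a\<^sub>n\<^sub>+\<^sub>1 = partial_quotient \<alpha> n\<close>, so indices are shifted by one.\<close>

definition partial_quotient :: "real \<Rightarrow> nat \<Rightarrow> int" where
  "partial_quotient \<alpha> n = \<lfloor>1 / (gauss_map ^^ n) \<alpha>\<rfloor>"

definition bounded_type :: "real \<Rightarrow> bool" where
  "bounded_type \<alpha> \<longleftrightarrow> \<alpha> \<notin> \<rat> \<and> (\<exists>K. \<forall>n. partial_quotient \<alpha> n \<le> K)"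

lemma gauss_map_irrational:
  assumes "\<alpha> \<notin> \<rat>"
  shows "(gauss_map ^^ n) \<alpha> \<notin> \<rat>"
proof (induction n)
  case 0
  then show ?case using assms by simp
next
  case (Suc n)
  let ?x = "(gauss_map ^^ n) \<alpha>"
  have "?x \<in> \<rat>" if "gauss_map ?x \<in> \<rat>"
  proof -
    have "1 / ?x = gauss_map ?x + of_int \<lfloor>1 / ?x\<rfloor>"
      by (simp add: gauss_map_def frac_def)
    then have "1 / ?x \<in> \<rat>"
      using that by (metis Rats_add Rats_of_int)
    then have "1 / (1 / ?x) \<in> \<rat>"
      using Rats_1 Rats_divide by blast
    then show ?thesis by simp
  qed
  with Suc show ?case by auto
qed

lemma partial_quotient_expansion:
  assumes "\<alpha> \<notin> \<rat>"
  shows "(gauss_map ^^ n) \<alpha> = 1 / (of_int (partial_quotient \<alpha> n) + (gauss_map ^^ Suc n) \<alpha>)"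
  using gauss_map_irrational[OF assms, of n]
  by (simp add: partial_quotient_def gauss_map_def frac_def)

section \<open>The circle and its rotations\<close>

text \<open>Measurability on the circle is Borel measurability. Since cohomology is an
  almost-everywhere relation, regularity is the same for Lebesgue-measurable functions.\<close>

definition circle :: "real measure" where
  "circle = restrict_space lborel {0..<1}"

definition rotation :: "real \<Rightarrow> real \<Rightarrow> real" where
  "rotation \<alpha> x = frac (x + \<alpha>)"

section \<open>Cocycles, cohomology and regularity\<close>

definition cocycle :: "(real \<Rightarrow> real ^ 'm) \<Rightarrow> bool" where
  "cocycle \<Phi> \<longleftrightarrow> \<Phi> \<in> borel_measurable circle"

definition cohomologous ::
  "(real \<Rightarrow> real) \<Rightarrow> (real \<Rightarrow> real ^ 'm) \<Rightarrow> (real \<Rightarrow> real ^ 'm) \<Rightarrow> bool" where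
  "cohomologous T \<Phi> \<Psi> \<longleftrightarrow>
     (\<exists>f \<in> borel_measurable circle. AE x in circle. \<Phi> x - \<Psi> x = f x - f (T x))"

definition closed_subgroup :: "(real ^ 'm) set \<Rightarrow> bool" where
  "closed_subgroup H \<longleftrightarrow>
     closed H \<and> 0 \<in> H \<and> (\<forall>x\<in>H. \<forall>y\<in>H. x + y \<in> H) \<and> (\<forall>x\<in>H. - x \<in> H)"

text \<open>A Haar measure on \<open>H\<close> is unique up to a positive factor, which does not affect
  ergodicity; Radon regularity is automatic because \<open>H\<close> is locally compact and second countable.\<close>

definition haar_measure_on :: "(real ^ 'm) set \<Rightarrow> (real ^ 'm) measure \<Rightarrow> bool" where
  "haar_measure_on H \<nu> \<longleftrightarrow>
     sets \<nu> = sets (restrict_space borel H) \<and>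
     (\<forall>h\<in>H. \<forall>A\<in>sets \<nu>. emeasure \<nu> ((\<lambda>x. h + x) ` A) = emeasure \<nu> A) \<and>
     (\<forall>K. compact K \<longrightarrow> K \<subseteq> H \<longrightarrow> emeasure \<nu> K < \<infinity>) \<and>
     emeasure \<nu> H \<noteq> 0"

text \<open>The measure may be infinite, hence the complement in the last condition.\<close>

definition ergodic :: "'a measure \<Rightarrow> ('a \<Rightarrow> 'a) \<Rightarrow> bool" where
  "ergodic M S \<longleftrightarrow>
     S \<in> measurable M M \<and> distr M M S = M \<and>
     (\<forall>A\<in>sets M. S -` A \<inter> space M = A \<longrightarrow> emeasure M A = 0 \<or> emeasure M (space M - A) = 0)"

definition skew_product ::
  "(real \<Rightarrow> real) \<Rightarrow> (real \<Rightarrow> real ^ 'm) \<Rightarrow> real \<times> (real ^ 'm) \<Rightarrow> real \<times> (real ^ 'm)" where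
  "skew_product T \<Psi> = (\<lambda>(x, h). (T x, h + \<Psi> x))"

definition regular_cocycle :: "(real \<Rightarrow> real) \<Rightarrow> (real \<Rightarrow> real ^ 'm) \<Rightarrow> bool" where
  "regular_cocycle T \<Phi> \<longleftrightarrow>
     (\<exists>\<Psi> H \<nu>. cocycle \<Psi> \<and> cohomologous T \<Phi> \<Psi> \<and>
        closed_subgroup H \<and> (\<forall>x\<in>space circle. \<Psi> x \<in> H) \<and>
        haar_measure_on H \<nu> \<and> ergodic (circle \<Otimes>\<^sub>M \<nu>) (skew_product T \<Psi>))"

section \<open>The sawtooth cocycle\<close>

definition sawtooth :: "real \<Rightarrow> real" where
  "sawtooth x = frac x - 1 / 2"

definition Psi4 :: "real \<Rightarrow> real \<Rightarrow> real \<Rightarrow> real \<Rightarrow> real ^ 4" where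
  "Psi4 \<beta> \<gamma> \<delta> x =
     vector [sawtooth x, sawtooth (x + \<beta>), sawtooth (x + \<gamma>), sawtooth (x + \<delta>)]"

lemma Psi4_nth:
  "Psi4 \<beta> \<gamma> \<delta> x $ 1 = sawtooth x"
  "Psi4 \<beta> \<gamma> \<delta> x $ 2 = sawtooth (x + \<beta>)"
  "Psi4 \<beta> \<gamma> \<delta> x $ 3 = sawtooth (x + \<gamma>)"
  "Psi4 \<beta> \<gamma> \<delta> x $ 4 = sawtooth (x + \<delta>)"
  by (simp_all add: Psi4_def vector_def)

lemma cocycle_Psi4: "cocycle (Psi4 \<beta> \<gamma> \<delta>)"
proof -
  have saw: "(\<lambda>x. sawtooth (x + c)) \<in> borel_measurable circle" for c
    unfolding sawtooth_def frac_def circle_def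
    by (intro measurable_restrict_space1) measurable
  have comp: "(\<lambda>x. Psi4 \<beta> \<gamma> \<delta> x $ i) \<in> borel_measurable circle" for i
    using exhaust_4[of i] saw[of 0] saw[of \<beta>] saw[of \<gamma>] saw[of \<delta>]
    by (auto simp: Psi4_nth)
  show ?thesis
    unfolding cocycle_def
    by (subst borel_measurable_euclidean_space)
       (auto simp: Basis_vec_def inner_axis comp)
qed

end

(* With \<phi> x = \<lfloor>x + \<beta>\<rfloor> - \<lfloor>x\<rfloor> and \<delta> = \<beta> + \<gamma>, an alternating sum of the four coordinates of \<Psi>\<^sub>4
   is the integer cocycle u x = \<phi> x - \<phi> (x + \<gamma>). Since \<alpha> is not of bounded type, there are
   denominators q\<^sub>k and multiplicities b\<^sub>k, with 2^k dividing b\<^sub>k, such that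
   \<sigma>\<^sub>k = q\<^sub>k \<alpha> - p\<^sub>k makes q\<^sub>k b\<^sub>k \<bar>\<sigma>\<^sub>k\<bar> summable. Put \<gamma> = \<Sum> b\<^sub>k \<sigma>\<^sub>k. Telescoping along the partial
   sums of \<gamma> makes u a formal sum of coboundaries, whose k-th transfer function is a Birkhoff sum
   of \<phi> over b\<^sub>k periods of length q\<^sub>k. Off a set of summable measure this transfer function is
   a multiple of b\<^sub>k, so u is a coboundary modulo 2^K for every K. If \<Psi>\<^sub>4 were cohomologous
   to an ergodic cocycle into H, invariance of the resulting characters of the skew product would
   force the alternating sum to vanish on H, so that u itself would be a coboundary. But
   \<beta> is chosen with q\<^sub>k \<beta> close to 1/2 modulo 1: then translation by about half a period
   changes the k-th transfer function by b\<^sub>k on a set of measure bounded below, and as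
   b\<^sub>k dominates the earlier terms, the Birkhoff sums of u are not tight. *)
theory Submission
  imports Defs "HOL-Library.Real_Mod"
begin

section \<open>Approximation of numbers that are not of bounded type\<close>

lemma gauss_map_in_01:
  assumes "x \<notin> \<rat>"
  shows "gauss_map x \<in> {0<..<1}" "gauss_map x \<notin> \<rat>"
proof -
  show irr: "gauss_map x \<notin> \<rat>"
    using gauss_map_irrational[OF assms, of 1] by simp
  then have "gauss_map x \<noteq> 0"
    by (metis Rats_0)
  then show "gauss_map x \<in> {0<..<1}"
    using frac_ge_0[of "1/x"] frac_lt_1[of "1/x"] by (auto simp: gauss_map_def less_le)
qed

text \<open>Pulling an approximation of \<open>gauss_map x\<close> back to \<open>x\<close> flips the sign of the error
  \<open>s\<close> and changes \<open>\<bar>q s\<bar>\<close> by \<open>x s\<^sup>2\<close>, alternately downwards and upwards; the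
  summand \<open>s\<^sup>2\<close> for negative \<open>s\<close> pays for the next upward change.\<close>

lemma approximation_from_gauss_orbit:
  fixes x :: real
  assumes "x \<notin> \<rat>" "0 < x" "x < 1"
  shows "\<exists>(q::nat) (p::int). q \<ge> 1 \<and> p \<ge> 0 \<and> coprime p (int q) \<and>
    (let s = q * x - p in (s > 0 \<and> q * s \<le> (gauss_map ^^ n) x) \<or>
                          (s < 0 \<and> - (q * s) + s\<^sup>2 \<le> (gauss_map ^^ n) x))"
  using assms
proof (induction n arbitrary: x)
  case 0
  \<comment> \<open>With \<open>q = 1\<close> and \<open>p = 0\<close> the error is \<open>x\<close>
    itself, so the first alternative holds with equality.\<close>
  then show ?case by (intro exI[of _ 1] exI[of _ 0]) auto
next
  case (Suc n)
  define y where "y = gauss_map x"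
  define a where "a = \<lfloor>1/x\<rfloor>"
  have y: "y \<notin> \<rat>" "0 < y" "y < 1"
    using gauss_map_in_01[OF Suc.prems(1)] by (auto simp: y_def)
  have it: "(gauss_map ^^ Suc n) x = (gauss_map ^^ n) y"
    by (simp only: funpow_Suc_right o_apply y_def)
  obtain q :: nat and p :: int where qp: "q \<ge> 1" "p \<ge> 0" "coprime p (int q)" and
    alt: "(q * y - p > 0 \<and> q * (q * y - p) \<le> (gauss_map ^^ n) y) \<or>
          (q * y - p < 0 \<and> - (q * (q * y - p)) + (q * y - p)\<^sup>2 \<le> (gauss_map ^^ n) y)"
    using Suc.IH[OF y] by (auto simp: Let_def)
  have a: "a \<ge> 1"
    using Suc.prems by (simp add: a_def le_floor_iff)
  have yx: "y = 1/x - a" by (simp add: y_def gauss_map_def frac_def a_def)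
  \<comment> \<open>Since \<open>x = 1 / (a + y)\<close>, the fraction \<open>p / q\<close> for
    \<open>y\<close> becomes \<open>q / (q * a + p)\<close> for \<open>x\<close>. The condition
    \<open>p \<ge> 0\<close> in the induction keeps the new denominator positive.\<close>
  define q' where "q' = nat (q * a + p)"
  have pos: "q * a + p \<ge> 1"
    using a qp by (smt (verit) mult_le_0_iff of_nat_1 of_nat_mono)
  have q': "int q' = q * a + p" using pos by (simp add: q'_def)
  define s where "s = q * y - p"
  have rq': "real q' = q * a + p"
    using arg_cong[OF q', of real_of_int] by simp
  have s': "q' * x - int q = - x * s"
    unfolding rq' s_def yx using Suc.prems by (simp add: field_simps)
  have qs': "q' * (x * s) = q * s - x * s\<^sup>2"
  proof -
    have "q' * x = q - x * s" using s' by simp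
    then have "(q' * x) * s = (q - x * s) * s" by simp
    then show ?thesis by (simp add: algebra_simps power2_eq_square)
  qed
  have cop: "coprime (int q) (int q')"
    unfolding q' using qp(3) by (metis coprime_commute coprime_iff_gcd_eq_1 gcd_add_mult gcd.commute mult.commute)
  have xs: "x\<^sup>2 * s\<^sup>2 \<le> x * s\<^sup>2" "x * s\<^sup>2 \<le> s\<^sup>2"
    using Suc.prems by (auto intro!: mult_right_mono mult_left_le_one_le simp: power2_eq_square)
  have alt': "(s > 0 \<and> q * s \<le> (gauss_map ^^ n) y) \<or> (s < 0 \<and> - (q * s) + s\<^sup>2 \<le> (gauss_map ^^ n) y)"
    using alt by (simp add: s_def)
  then have "(q' * x - int q > 0 \<and> q' * (q' * x - int q) \<le> (gauss_map ^^ n) y) \<or>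
    (q' * x - int q < 0 \<and> - (q' * (q' * x - int q)) + (q' * x - int q)\<^sup>2 \<le> (gauss_map ^^ n) y)"
    unfolding s'
  proof
    assume "s > 0 \<and> q * s \<le> (gauss_map ^^ n) y"
    moreover have "- (q' * (- x * s)) + (- x * s)\<^sup>2 = q * s - x * s\<^sup>2 + x\<^sup>2 * s\<^sup>2"
      using qs' by (simp add: power_mult_distrib)
    ultimately have "- x * s < 0" "- (q' * (- x * s)) + (- x * s)\<^sup>2 \<le> (gauss_map ^^ n) y"
      using Suc.prems xs(1) by (simp, linarith)
    then show "- x * s > 0 \<and> q' * (- x * s) \<le> (gauss_map ^^ n) y \<or>
      - x * s < 0 \<and> - (q' * (- x * s)) + (- x * s)\<^sup>2 \<le> (gauss_map ^^ n) y" by blast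
  next
    assume "s < 0 \<and> - (q * s) + s\<^sup>2 \<le> (gauss_map ^^ n) y"
    moreover have "q' * (- x * s) = - (q * s) + x * s\<^sup>2"
      using qs' by simp
    ultimately have "- x * s > 0" "q' * (- x * s) \<le> (gauss_map ^^ n) y"
      using Suc.prems xs(2) by (simp add: mult_pos_neg, linarith)
    then show "- x * s > 0 \<and> q' * (- x * s) \<le> (gauss_map ^^ n) y \<or>
      - x * s < 0 \<and> - (q' * (- x * s)) + (- x * s)\<^sup>2 \<le> (gauss_map ^^ n) y" by blast
  qed
  then show ?case
    unfolding it Let_def using cop pos q' by (intro exI[of _ q'] exI[of _ "int q"]) auto
qed

lemma irrational_combination_nonzero:
  fixes \<alpha> :: real and q :: nat and p :: int
  assumes "\<alpha> \<notin> \<rat>" "q \<ge> 1"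
  shows "q * \<alpha> - p \<noteq> 0"
proof
  assume "q * \<alpha> - p = 0"
  then have "\<alpha> = p / q" using assms(2) by (simp add: field_simps)
  then show False using assms(1) by auto
qed

text \<open>Partial quotients are the integer parts of \<open>1 / x\<close> along the Gauss orbit,
  so a large one forces an orbit point of size at most \<open>\<epsilon>\<close>;
  \<open>approximation_from_gauss_orbit\<close> turns this point into an error bound.\<close>

lemma well_approximable:
  fixes \<alpha> \<epsilon> :: real
  assumes "\<alpha> \<notin> \<rat>" "0 < \<alpha>" "\<alpha> < 1" "\<not> bounded_type \<alpha>" "\<epsilon> > 0"
  shows "\<exists>(q::nat) (p::int). q \<ge> 1 \<and> coprime p (int q) \<and> q * \<bar>q * \<alpha> - p\<bar> \<le> \<epsilon>"
proof -
  obtain n where n: "partial_quotient \<alpha> n > \<lceil>1/\<epsilon>\<rceil>"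
    using assms(1,4) by (auto simp: bounded_type_def not_le)
  define x where "x = (gauss_map ^^ n) \<alpha>"
  have "1 / \<epsilon> < 1 / x"
    using n unfolding partial_quotient_def x_def by linarith
  then have x: "x \<le> \<epsilon>"
    using assms(5) by (smt (verit) frac_le)
  obtain q :: nat and p :: int where qp: "q \<ge> 1" "coprime p (int q)" and
    alt: "(q * \<alpha> - p > 0 \<and> q * (q * \<alpha> - p) \<le> x) \<or>
          (q * \<alpha> - p < 0 \<and> - (q * (q * \<alpha> - p)) + (q * \<alpha> - p)\<^sup>2 \<le> x)"
    using approximation_from_gauss_orbit[OF assms(1,2,3), of n] by (auto simp: Let_def x_def)
  have "q * \<bar>q * \<alpha> - p\<bar> \<le> x"
    using alt by (smt (verit) mult_minus_right zero_le_power2)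
  then show ?thesis using qp x by (intro exI[of _ q] exI[of _ p]) auto
qed

text \<open>Each multiple \<open>q * \<alpha>\<close> with \<open>1 \<le> q \<le> N\<close> keeps a
  positive distance from the integers. A tolerance below these finitely many distances excludes
  small denominators.\<close>

lemma well_approximable_large:
  fixes \<alpha> \<epsilon> :: real
  assumes "\<alpha> \<notin> \<rat>" "0 < \<alpha>" "\<alpha> < 1" "\<not> bounded_type \<alpha>" "\<epsilon> > 0"
  shows "\<exists>(q::nat) (p::int). q \<ge> N \<and> q \<ge> 1 \<and> coprime p (int q) \<and> q * \<bar>q * \<alpha> - p\<bar> \<le> \<epsilon>"
proof -
  define d where "d q = \<bar>real q * \<alpha> - of_int (round (real q * \<alpha>))\<bar>" for q :: nat
  \<comment> \<open>Halving the distances makes \<open>D < d q\<close> strict; inserting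
    \<open>\<epsilon>\<close> keeps the set nonempty when \<open>N = 0\<close>.\<close>
  define D where "D = Min (insert \<epsilon> ((\<lambda>q. d q / 2) ` {1..N}))"
  have dpos: "d q > 0" if "q \<ge> 1" for q
    using irrational_combination_nonzero[OF assms(1) that] by (simp add: d_def)
  have D: "D > 0" "D \<le> \<epsilon>" "\<And>q. q \<in> {1..N} \<Longrightarrow> D < d q"
  proof -
    show "D > 0" unfolding D_def using assms(5) dpos by (subst Min_gr_iff) auto
    show "D \<le> \<epsilon>" unfolding D_def by (rule Min_le) auto
    show "D < d q" if "q \<in> {1..N}" for q
    proof -
      have "D \<le> d q / 2" unfolding D_def using that by (intro Min_le) auto
      then show ?thesis using dpos[of q] that by simp
    qed
  qed
  obtain q :: nat and p :: int where qp: "q \<ge> 1" "coprime p (int q)" "q * \<bar>q * \<alpha> - p\<bar> \<le> D"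
    using well_approximable[OF assms(1-4) D(1)] by auto
  have "d q \<le> \<bar>q * \<alpha> - p\<bar>"
    unfolding d_def using round_diff_minimal[of "q * \<alpha>" p] by simp
  also have "\<dots> \<le> q * \<bar>q * \<alpha> - p\<bar>"
    using qp(1) by (simp add: mult_le_cancel_right1)
  finally have "d q \<le> D" using qp(3) by simp
  then have "q \<ge> N" using D(3)[of q] qp(1) by fastforce
  then show ?thesis using qp D(2) by (intro exI[of _ q] exI[of _ p]) auto
qed

section \<open>Lebesgue measure on the circle\<close>

lemma space_circle [simp]: "space circle = {0..<1}"
  by (simp add: circle_def space_restrict_space)

lemma sets_circle: "sets circle = sets (restrict_space borel {0..<1})"
  by (simp add: circle_def sets_restrict_space)

lemma in_sets_circle [simp]: "A \<in> sets circle \<longleftrightarrow> A \<in> sets borel \<and> A \<subseteq> {0..<1}"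
  by (auto simp: sets_circle sets_restrict_space_iff)

lemma emeasure_circle:
  assumes "A \<in> sets borel" "A \<subseteq> {0..<1}"
  shows "emeasure circle A = emeasure lborel A"
  unfolding circle_def using assms by (intro emeasure_restrict_space) auto

lemma emeasure_space_circle: "emeasure circle {0..<1} = 1"
  by (simp add: emeasure_circle)

lemma finite_measure_circle: "finite_measure circle"
  by (rule finite_measureI) (simp add: emeasure_circle)

lemma frac_borel_measurable [measurable]: "(frac :: real \<Rightarrow> real) \<in> borel_measurable borel"
  unfolding frac_def by measurable

lemma frac_add_frac_left [simp]: "frac (frac x + y) = frac (x + y :: real)"
  unfolding frac_def by (simp add: algebra_simps)

lemma frac_add_frac_right [simp]: "frac (x + frac y) = frac (x + y :: real)"
  using frac_add_frac_left[of y x] by (simp add: add.commute)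

text \<open>The integer \<open>\<lceil>a\<rceil>\<close> cuts the interval into two pieces;
  translated by suitable integers they fit together to the unit interval.\<close>

lemma emeasure_periodic_unit_interval:
  fixes A :: "real set"
  assumes [measurable]: "A \<in> sets borel" and per: "\<And>x. x + 1 \<in> A \<longleftrightarrow> x \<in> A"
  shows "emeasure lborel (A \<inter> {a..<a+1}) = emeasure lborel (A \<inter> {0..<1})"
proof -
  have per': "x + of_int n \<in> A \<longleftrightarrow> x \<in> A" for x n
  proof (induction n rule: int_induct[where k = 0])
    case (step1 i)
    then show ?case using per[of "x + of_int i"] by (simp add: algebra_simps)
  next
    case (step2 i)
    then show ?case using per[of "x + of_int (i - 1)"] by (simp add: algebra_simps)
  qed simp
  have shift: "emeasure lborel (A \<inter> {c..<d}) = emeasure lborel (A \<inter> {c - of_int n..<d - of_int n})" for c d n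
  proof -
    have "emeasure lborel (A \<inter> {c..<d}) = emeasure (distr lborel borel ((+) (of_int n))) (A \<inter> {c..<d})"
      by (simp add: lborel_distr_plus)
    also have "\<dots> = emeasure lborel (((+) (of_int n)) -` (A \<inter> {c..<d}) \<inter> space lborel)"
      by (rule emeasure_distr) auto
    also have "((+) (of_int n)) -` (A \<inter> {c..<d}) \<inter> space lborel = A \<inter> {c - of_int n..<d - of_int n}"
    proof -
      have "of_int n + x \<in> A \<longleftrightarrow> x \<in> A" for x using per'[of x n] by (simp add: add.commute)
      then show ?thesis by auto
    qed
    finally show ?thesis .
  qed
  define n where "n = \<lceil>a\<rceil>"
  have n: "a \<le> of_int n" "of_int n < a + 1" unfolding n_def by linarith+
  have "emeasure lborel (A \<inter> {a..<a+1}) = emeasure lborel ((A \<inter> {a..<of_int n}) \<union> (A \<inter> {of_int n..<a+1}))"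
    using n by (intro arg_cong[of _ _ "emeasure lborel"]) auto
  also have "\<dots> = emeasure lborel (A \<inter> {a..<of_int n}) + emeasure lborel (A \<inter> {of_int n..<a+1})"
    by (rule plus_emeasure[symmetric]) auto
  also have "emeasure lborel (A \<inter> {a..<of_int n}) = emeasure lborel (A \<inter> {a + 1 - of_int n..<1})"
  proof -
    have "a - of_int (n - 1) = a + 1 - of_int n" "of_int n - of_int (n - 1) = (1::real)" by simp_all
    then show ?thesis by (simp only: shift[of a "of_int n" "n - 1"])
  qed
  also have "emeasure lborel (A \<inter> {of_int n..<a+1}) = emeasure lborel (A \<inter> {0..<a+1-of_int n})"
    by (simp only: shift[of "of_int n" "a+1" n] diff_self)
  also have "emeasure lborel (A \<inter> {a + 1 - of_int n..<1}) + emeasure lborel (A \<inter> {0..<a+1-of_int n})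
    = emeasure lborel ((A \<inter> {a + 1 - of_int n..<1}) \<union> (A \<inter> {0..<a+1-of_int n}))"
    by (rule plus_emeasure) auto
  also have "(A \<inter> {a + 1 - of_int n..<1}) \<union> (A \<inter> {0..<a+1-of_int n}) = A \<inter> {0..<1}"
    using n by auto
  finally show ?thesis .
qed

lemma emeasure_periodic_interval:
  fixes A :: "real set" and a :: real and q :: nat
  assumes [measurable]: "A \<in> sets borel" and per: "\<And>x. x + 1 \<in> A \<longleftrightarrow> x \<in> A"
  shows "emeasure lborel (A \<inter> {a..<a + q}) = q * emeasure lborel (A \<inter> {0..<1})"
proof (induction q)
  case (Suc q)
  have "emeasure lborel (A \<inter> {a..<a + Suc q}) =
    emeasure lborel ((A \<inter> {a..<a+q}) \<union> (A \<inter> {a+q..<a+q+1}))"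
    by (intro arg_cong[of _ _ "emeasure lborel"]) auto
  also have "\<dots> = emeasure lborel (A \<inter> {a..<a+q}) + emeasure lborel (A \<inter> {a+q..<a+q+1})"
    by (rule plus_emeasure[symmetric]) auto
  also have "\<dots> = Suc q * emeasure lborel (A \<inter> {0..<1})"
    unfolding Suc emeasure_periodic_unit_interval[OF assms, of "a + q"]
    by (simp add: distrib_right add.commute)
  finally show ?case .
qed simp

text \<open>The map \<open>x \<mapsto> q * x + c\<close> stretches lengths by \<open>q\<close> and
  covers \<open>q\<close> periods of \<open>A\<close>, so the two factors \<open>q\<close>
  cancel.\<close>

lemma emeasure_periodic_affine:
  fixes A :: "real set" and c :: real and q :: nat
  assumes [measurable]: "A \<in> sets borel" and per: "\<And>x. x + 1 \<in> A \<longleftrightarrow> x \<in> A" and q: "q \<ge> 1"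
  shows "emeasure circle {x \<in> {0..<1}. real q * x + c \<in> A} = emeasure lborel (A \<inter> {0..<1})"
proof -
  have "q * emeasure lborel (A \<inter> {0..<1}) = emeasure lborel (A \<inter> {c..<c + q})"
    using emeasure_periodic_interval[OF assms(1,2)] by simp
  also have "\<dots> = (\<integral>\<^sup>+x. indicator (A \<inter> {c..<c + q}) x \<partial>lborel)"
    by simp
  also have "\<dots> = ennreal \<bar>real q\<bar> * (\<integral>\<^sup>+x. indicator (A \<inter> {c..<c + q}) (c + real q * x) \<partial>lborel)"
    using q by (intro nn_integral_real_affine) auto
  also have "(\<lambda>x::real. indicator (A \<inter> {c..<c + q}) (c + real q * x) :: ennreal) =
    indicator {x \<in> {0..<1::real}. real q * x + c \<in> A}"
    using q by (auto simp: fun_eq_iff indicator_def add.commute zero_le_mult_iff)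
  also have "(\<integral>\<^sup>+x. indicator {x \<in> {0..<1::real}. real q * x + c \<in> A} x \<partial>lborel) =
    emeasure lborel {x \<in> {0..<1::real}. real q * x + c \<in> A}"
    by (rule nn_integral_indicator) auto
  finally have "ennreal q * emeasure lborel (A \<inter> {0..<1}) = ennreal q * emeasure lborel {x \<in> {0..<1::real}. real q * x + c \<in> A}"
    by (simp add: ennreal_of_nat_eq_real_of_nat)
  then have "emeasure lborel (A \<inter> {0..<1}) = emeasure lborel {x \<in> {0..<1::real}. real q * x + c \<in> A}"
    using q by (subst (asm) ennreal_mult_cancel_left) auto
  then show ?thesis by (subst emeasure_circle) auto
qed

lemma measure_circle_frac_affine:
  fixes l r c :: real and q :: nat
  assumes "0 \<le> l" "l \<le> r" "r < 1" "q \<ge> 1"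
  shows "measure circle {x \<in> {0..<1}. frac (real q * x + c) \<in> {l..r}} = r - l"
proof -
  have "emeasure circle {x \<in> {0..<1}. real q * x + c \<in> {y. frac y \<in> {l..r}}} =
    emeasure lborel ({y. frac y \<in> {l..r}} \<inter> {0..<1})"
    using assms by (intro emeasure_periodic_affine) (auto simp: frac_def)
  also have "{y. frac y \<in> {l..r}} \<inter> {0..<1} = {l..r}"
    using assms by (auto simp: frac_eq[THEN iffD2])
  finally show ?thesis using assms by (simp add: measure_def)
qed

section \<open>Rotations preserve the measure of the circle\<close>

lemma rotation_measurable [measurable]: "rotation c \<in> measurable circle circle"
proof -
  have "rotation c \<in> borel_measurable circle"
    unfolding rotation_def circle_def by (intro measurable_restrict_space1) measurable
  then show ?thesis
    unfolding circle_def
    by (intro measurable_restrict_space2)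
       (auto simp: rotation_def frac_lt_1 space_restrict_space cong: measurable_cong_sets)
qed

lemma rotation_in_circle [simp]: "0 \<le> rotation c x" "rotation c x < 1"
  by (auto simp: rotation_def frac_lt_1)

lemma distr_rotation: "distr circle circle (rotation c) = circle"
proof (rule measure_eqI)
  fix A assume "A \<in> sets (distr circle circle (rotation c))"
  then have A [measurable]: "A \<in> sets borel" and sub: "A \<subseteq> {0..<1}" by auto
  have "emeasure (distr circle circle (rotation c)) A = emeasure circle (rotation c -` A \<inter> space circle)"
    using A sub by (intro emeasure_distr) auto
  also have "rotation c -` A \<inter> space circle = {x \<in> {0..<1}. real 1 * x + c \<in> {y. frac y \<in> A}}"
    by (auto simp: rotation_def)
  also have "emeasure circle \<dots> = emeasure lborel ({y. frac y \<in> A} \<inter> {0..<1})"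
    by (intro emeasure_periodic_affine) (auto simp: frac_def)
  also have "{y. frac y \<in> A} \<inter> {0..<1} = A"
    using sub by (auto simp: frac_eq[THEN iffD2])
  finally show "emeasure (distr circle circle (rotation c)) A = emeasure circle A"
    using sub by (simp add: emeasure_circle)
qed simp

lemma AE_circle_rotation:
  assumes "AE x in circle. P x"
  shows "AE x in circle. P (rotation c x)"
proof -
  obtain N where N: "N \<in> null_sets circle" "{x \<in> space circle. \<not> P x} \<subseteq> N"
    using assms by (auto elim!: AE_E simp: null_sets_def)
  have "AE x in distr circle circle (rotation c). x \<notin> N"
    unfolding distr_rotation using N(1) by (rule AE_not_in)
  then have "AE x in circle. rotation c x \<notin> N"
    by (rule AE_distrD[rotated]) simp
  moreover have "P (rotation c x)" if "rotation c x \<notin> N" for x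
  proof (rule ccontr)
    assume "\<not> P (rotation c x)"
    then have "rotation c x \<in> {x \<in> space circle. \<not> P x}" by simp
    then show False using that N(2) by blast
  qed
  ultimately show ?thesis by (auto elim!: AE_mp)
qed

lemma measure_circle_rotation:
  assumes "A \<in> sets circle"
  shows "measure circle (rotation c -` A \<inter> {0..<1}) = measure circle A"
  using measure_distr[of "rotation c" circle circle A] assms by (simp add: distr_rotation)

section \<open>Distance to the integers, where the floor function jumps\<close>

definition near_int :: "real \<Rightarrow> real \<Rightarrow> bool" where
  "near_int r y \<longleftrightarrow> (\<exists>z::int. \<bar>y - of_int z\<bar> \<le> r)"

lemma near_int_iff_frac: "near_int r y \<longleftrightarrow> frac y \<le> r \<or> 1 - r \<le> frac y"
proof
  assume "near_int r y"
  then obtain z :: int where z: "\<bar>y - of_int z\<bar> \<le> r" by (auto simp: near_int_def)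
  show "frac y \<le> r \<or> 1 - r \<le> frac y"
  proof (cases "y \<ge> of_int z")
    case True
    then have "z \<le> \<lfloor>y\<rfloor>" by (simp add: le_floor_iff)
    then have "real_of_int z \<le> of_int \<lfloor>y\<rfloor>" by simp
    then show ?thesis using z unfolding frac_def by linarith
  next
    case False
    then have "\<lfloor>y\<rfloor> \<le> z - 1" by linarith
    then have "of_int \<lfloor>y\<rfloor> \<le> real_of_int z - 1" by linarith
    then show ?thesis using z unfolding frac_def by linarith
  qed
next
  assume "frac y \<le> r \<or> 1 - r \<le> frac y"
  then show "near_int r y"
  proof
    assume "frac y \<le> r"
    then show ?thesis unfolding near_int_def frac_def
      by (intro exI[of _ "\<lfloor>y\<rfloor>"]) linarith
  next
    assume "1 - r \<le> frac y"
    then show ?thesis unfolding near_int_def frac_def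
      by (intro exI[of _ "\<lfloor>y\<rfloor> + 1"]) linarith
  qed
qed

lemma pred_near_int [measurable]: "Measurable.pred borel (near_int r)"
  unfolding near_int_iff_frac by measurable

lemma near_int_mono: "near_int r y \<Longrightarrow> r \<le> s \<Longrightarrow> near_int s y"
  unfolding near_int_def by (meson order_trans)

text \<open>Multiplication by \<open>q\<close> clears the fraction \<open>j / q\<close>. Hence a
  single condition on \<open>q * y\<close> keeps all the points \<open>y + j / q\<close> away from
  the integers.\<close>

lemma near_int_multiple:
  fixes r y :: real and q :: nat and j :: int
  assumes "near_int r (y + j / q)" "q \<ge> 1"
  shows "near_int (q * r) (q * y)"
proof -
  obtain z :: int where z: "\<bar>y + j / q - z\<bar> \<le> r" using assms by (auto simp: near_int_def)
  have "q * y - of_int (q * z - j) = q * (y + j / q - z)"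
    using assms(2) by (simp add: field_simps)
  then have "\<bar>q * y - of_int (q * z - j)\<bar> \<le> q * r"
    using z by (simp add: abs_mult mult_left_mono)
  then show ?thesis unfolding near_int_def by blast
qed

lemma measure_near_int_affine:
  fixes r c :: real and q :: nat
  assumes "q \<ge> 1" "0 \<le> r"
  shows "measure circle {x \<in> {0..<1}. near_int r (real q * x + c)} \<le> 2 * r"
proof -
  have "emeasure circle {x \<in> {0..<1}. real q * x + c \<in> {y. near_int r y}} =
    emeasure lborel ({y. near_int r y} \<inter> {0..<1})"
    using assms by (intro emeasure_periodic_affine) (auto simp: near_int_iff_frac frac_def)
  also have "\<dots> \<le> emeasure lborel ({0..r} \<union> {1-r..1})"
    by (intro emeasure_mono) (auto simp: near_int_iff_frac frac_eq[THEN iffD2])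
  also have "\<dots> \<le> emeasure lborel {0..r} + emeasure lborel {1-r..1}"
    by (intro emeasure_subadditive) auto
  also have "\<dots> = ennreal (2 * r)"
    using assms by (simp flip: ennreal_plus)
  finally show ?thesis using assms(2) by (simp add: measure_def enn2real_leI)
qed

lemma floor_add_eq_floor:
  fixes y :: real
  assumes "\<not> near_int r y" "\<bar>e\<bar> \<le> r"
  shows "\<lfloor>y + e\<rfloor> = \<lfloor>y\<rfloor>"
proof -
  have "r < frac y" "frac y < 1 - r"
    using assms by (auto simp: near_int_iff_frac)
  then show ?thesis using assms(2) unfolding frac_def by linarith
qed

section \<open>The step cocycle and its transfer functions\<close>

text \<open>For \<open>0 \<le> \<beta> < 1\<close> this is the indicator function of the arc
  \<open>[1 - \<beta>, 1)\<close> of the circle. The formula with floors also covers the parameter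
  \<open>q * \<beta>\<close> that appears in sums over a period of a rational rotation.\<close>

definition step :: "real \<Rightarrow> real \<Rightarrow> int" where
  "step \<beta> x = \<lfloor>x + \<beta>\<rfloor> - \<lfloor>x\<rfloor>"

lemma step_add_of_int [simp]: "step \<beta> (x + of_int k) = step \<beta> x"
proof -
  have "x + of_int k + \<beta> = (x + \<beta>) + of_int k" by simp
  then show ?thesis unfolding step_def by (simp only: floor_add_int[symmetric])
qed

lemma step_frac: "step \<beta> (frac x + c) = step \<beta> (x + c)"
proof -
  have "x + c = (frac x + c) + of_int \<lfloor>x\<rfloor>" by (simp add: frac_def)
  then show ?thesis by (simp only: step_add_of_int)
qed

lemma step_bounds:
  assumes "0 \<le> \<beta>" "\<beta> < 1"
  shows "0 \<le> step \<beta> x" "step \<beta> x \<le> 1"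
  using assms unfolding step_def by linarith+

lemma step_measurable [measurable]: "(\<lambda>x. step \<beta> x) \<in> borel \<rightarrow>\<^sub>M count_space UNIV"
  unfolding step_def by measurable

lemma step_add_eq:
  assumes "\<not> near_int r x" "\<not> near_int r (x + \<beta>)" "\<bar>e\<bar> \<le> r"
  shows "step \<beta> (x + e) = step \<beta> x"
proof -
  have "x + e + \<beta> = (x + \<beta>) + e" by simp
  then show ?thesis
    unfolding step_def by (simp only: floor_add_eq_floor[OF assms(1,3)] floor_add_eq_floor[OF assms(2,3)])
qed

section \<open>Sums of floors over the orbit of a rational rotation\<close>

lemma sum_consecutive_div:
  fixes m :: int and q :: nat
  assumes "q \<ge> 1"
  shows "(\<Sum>i<q. (m + int i) div int q) = m"
proof -
  \<comment> \<open>Raising \<open>m\<close> by one shifts the window of \<open>q\<close>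
    consecutive numerators, so only the two end terms matter. Induction in both directions from
    \<open>m = 0\<close>, where all quotients vanish, then reaches every integer.\<close>
  have step: "(\<Sum>i<q. (m + 1 + int i) div int q) = (\<Sum>i<q. (m + int i) div int q) + 1" for m
  proof -
    have "(\<Sum>i<q. (m + 1 + int i) div int q) - (\<Sum>i<q. (m + int i) div int q) =
      (\<Sum>i<q. (m + int (Suc i)) div int q - (m + int i) div int q)"
      by (simp add: sum_subtractf add.assoc)
    also have "\<dots> = (m + int q) div int q - m div int q"
      by (subst sum_lessThan_telescope) simp
    also have "\<dots> = 1" using assms by simp
    finally show ?thesis by simp
  qed
  show ?thesis
  proof (induction m rule: int_induct[where k = 0])
    case base
    then show ?case by (auto intro!: sum.neutral)
  next
    case (step1 i)
    then show ?case using step[of i] by simp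
  next
    case (step2 i)
    then show ?case using step[of "i - 1"] by simp
  qed
qed

text \<open>Hermite's identity. The floor of \<open>(q * y + i) / q\<close> depends only on
  \<open>\<lfloor>q * y\<rfloor> + i\<close>, which reduces it to integer division.\<close>

lemma sum_floor_equidistant:
  fixes q :: nat and y :: real
  assumes "q \<ge> 1"
  shows "(\<Sum>i<q. \<lfloor>y + i / q\<rfloor>) = \<lfloor>q * y\<rfloor>"
proof -
  have "\<lfloor>y + i / q\<rfloor> = (\<lfloor>q * y\<rfloor> + int i) div int q" for i :: nat
  proof -
    have "y + i / q = (q * y + of_int (int i)) / real_of_int (int q)"
      using assms by (simp add: field_simps)
    then have "\<lfloor>y + i / q\<rfloor> = \<lfloor>q * y + of_int (int i)\<rfloor> div int q"
      by (simp only: floor_divide_real_eq_div[OF of_nat_0_le_iff])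
    then show ?thesis by (simp only: floor_add_int)
  qed
  then show ?thesis using sum_consecutive_div[OF assms] by simp
qed

text \<open>Multiplication by \<open>p\<close> permutes the residues modulo \<open>q\<close> because
  the two are coprime, and \<open>h\<close> sees its argument only modulo 1.\<close>

lemma sum_periodic_residues:
  fixes q :: nat and p :: int and h :: "real \<Rightarrow> 'a::comm_monoid_add"
  assumes q: "q \<ge> 1" and cop: "coprime p (int q)" and per: "\<And>x k. h (x + of_int k) = h x"
  shows "(\<Sum>i<q. h (y + of_int (int i * p) / q)) = (\<Sum>i<q. h (y + i / q))"
proof -
  define \<pi> where "\<pi> i = nat (int i * p mod int q)" for i :: nat
  have \<pi>: "int (\<pi> i) = int i * p mod int q" for i
    using q by (simp add: \<pi>_def)
  have "inj_on \<pi> {..<q}"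
  proof (rule inj_onI)
    fix i j assume ij: "i \<in> {..<q}" "j \<in> {..<q}" "\<pi> i = \<pi> j"
    then have "int i * p mod int q = int j * p mod int q" using \<pi> by metis
    then have "int q dvd (int i - int j) * p"
      by (simp add: mod_eq_dvd_iff left_diff_distrib)
    then have "int q dvd int i - int j"
      using cop by (simp add: coprime_commute coprime_dvd_mult_left_iff)
    then have "int i mod int q = int j mod int q" by (simp add: mod_eq_dvd_iff)
    then show "i = j" using ij by simp
  qed
  moreover have "\<pi> ` {..<q} \<subseteq> {..<q}"
    using q by (auto simp: \<pi>_def nat_less_iff)
  ultimately have bij: "bij_betw \<pi> {..<q} {..<q}"
    by (simp add: bij_betw_def endo_inj_surj)
  have "h (y + of_int (int i * p) / q) = h (y + \<pi> i / q)" for i :: nat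
  proof -
    define k where "k = int i * p div int q"
    have "int i * p = int q * k + int (\<pi> i)"
      by (simp add: \<pi> k_def)
    then have "of_int (int i * p) = q * of_int k + real (\<pi> i)"
      by simp
    then have "y + of_int (int i * p) / q = (y + \<pi> i / q) + of_int k"
      using q by (simp add: add_divide_distrib)
    then show ?thesis by (simp only: per)
  qed
  then show ?thesis using sum.reindex_bij_betw[OF bij, of "\<lambda>i. h (y + i / q)"] by simp
qed

text \<open>The orbit of the rotation by \<open>p / q\<close> is modulo 1 a reordering of the points
  \<open>y + i / q\<close>; Hermite's identity then applies to each of the two floors in
  \<open>step\<close>.\<close>

lemma sum_step_rational:
  fixes \<beta> y :: real and q :: nat and p :: int
  assumes "q \<ge> 1" "coprime p (int q)"
  shows "(\<Sum>i<q. step \<beta> (y + of_int (int i * p) / q)) = step (q * \<beta>) (q * y)"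
proof -
  have "(\<Sum>i<q. step \<beta> (y + of_int (int i * p) / q)) = (\<Sum>i<q. step \<beta> (y + i / q))"
    by (rule sum_periodic_residues[OF assms]) simp
  also have "\<dots> = (\<Sum>i<q. \<lfloor>(y + \<beta>) + i / q\<rfloor>) - (\<Sum>i<q. \<lfloor>y + i / q\<rfloor>)"
    by (simp add: step_def sum_subtractf add.assoc add.commute add.left_commute)
  also have "\<dots> = step (q * \<beta>) (q * y)"
    unfolding sum_floor_equidistant[OF assms(1)] by (simp add: step_def distrib_left)
  finally show ?thesis .
qed

text \<open>Along \<open>b\<close> periods of length \<open>q\<close> the orbit stays within \<open>b \<bar>q \<alpha> - p\<bar>\<close> of a rational
  orbit, so away from the discontinuities each period contributes the same integer.\<close>

lemma sum_step_periods:
  fixes q b :: nat and p :: int and \<alpha> \<beta> r y :: real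
  assumes q: "q \<ge> 1" and cop: "coprime p (int q)" and r: "r = b * \<bar>q * \<alpha> - p\<bar>"
    and far: "\<not> near_int (q * r) (q * y)" "\<not> near_int (q * r) (q * (y + \<beta>))"
  shows "(\<Sum>l<b * q. step \<beta> (y + l * \<alpha>)) = int b * step (q * \<beta>) (q * y)"
proof -
  define \<sigma> where "\<sigma> = q * \<alpha> - p"
  have one_term: "step \<beta> (y + real (i + s * q) * \<alpha>) = step \<beta> (y + of_int (int i * p) / q)"
    if "i < q" "s < b" for i s :: nat
  proof -
    \<comment> \<open>With \<open>q * \<alpha> = p + \<sigma>\<close>, the time
      \<open>i + s * q\<close> moves \<open>y\<close> by \<open>i * p / q\<close>, by the integer
      \<open>s * p\<close> and by this error, which is at most \<open>r\<close> in modulus because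
      \<open>s + i / q \<le> b\<close>.\<close>
    define e where "e = (s + i / q) * \<sigma>"
    have "y + real (i + s * q) * \<alpha> = (y + of_int (int i * p) / q + e) + of_int (int s * p)"
      using q by (simp add: e_def \<sigma>_def field_simps)
    then have *: "step \<beta> (y + real (i + s * q) * \<alpha>) = step \<beta> (y + of_int (int i * p) / q + e)"
      by (simp only: step_add_of_int)
    have "real s + 1 \<le> b" using that by linarith
    moreover have "i / q \<le> (1::real)" using that by simp
    ultimately have "s + i / q \<le> (b::real)" by linarith
    then have "\<bar>e\<bar> \<le> r"
      unfolding e_def r \<sigma>_def[symmetric] abs_mult by (intro mult_right_mono) auto
    moreover have "\<not> near_int r (y + of_int (int i * p) / q)"
      using near_int_multiple[OF _ q] far(1) by blast
    moreover have "\<not> near_int r (y + of_int (int i * p) / q + \<beta>)"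
    proof -
      have "y + of_int (int i * p) / q + \<beta> = (y + \<beta>) + of_int (int i * p) / q" by simp
      then show ?thesis using near_int_multiple[OF _ q] far(2) by metis
    qed
    ultimately have "step \<beta> (y + of_int (int i * p) / q + e) = step \<beta> (y + of_int (int i * p) / q)"
      by (intro step_add_eq)
    then show ?thesis using * by simp
  qed
  have "(\<Sum>l<b * q. step \<beta> (y + l * \<alpha>)) = (\<Sum>s<b. \<Sum>l = s*q..<s*q+q. step \<beta> (y + l * \<alpha>))"
    by (rule sum.nat_group[symmetric])
  also have "\<dots> = (\<Sum>s<b. \<Sum>i<q. step \<beta> (y + real (i + s * q) * \<alpha>))"
  proof (rule sum.cong[OF refl])
    fix s :: nat
    show "(\<Sum>l = s*q..<s*q+q. step \<beta> (y + real l * \<alpha>)) = (\<Sum>i<q. step \<beta> (y + real (i + s * q) * \<alpha>))"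
      using sum.shift_bounds_nat_ivl[of "\<lambda>l. step \<beta> (y + real l * \<alpha>)" 0 "s * q" q]
      by (simp add: lessThan_atLeast0 add.commute)
  qed
  also have "\<dots> = (\<Sum>s<b. \<Sum>i<q. step \<beta> (y + of_int (int i * p) / q))"
    using one_term by (intro sum.cong refl) auto
  also have "\<dots> = int b * step (q * \<beta>) (q * y)"
    unfolding sum_step_rational[OF q cop] by simp
  finally show ?thesis .
qed

text \<open>Both \<open>\<bar>s\<bar>\<close> and the fractional part of \<open>c\<close> are close
  to a half. A positive \<open>s\<close> raises only the floor of \<open>w + c\<close>, a negative
  one lowers only that of \<open>w\<close>; either way the difference grows by one. The lower end
  1/8 of the range for \<open>w\<close> is twice the tolerance 1/16.\<close>

lemma step_half_shift:
  fixes w s c :: real and N :: int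
  assumes w: "frac w \<in> {1/8..3/8}" and c: "\<bar>c - N - 1/2\<bar> \<le> 1/16"
    and s: "\<bar>\<bar>s\<bar> - 1/2\<bar> \<le> 1/16"
  shows "step c (w + s) = step c w + 1"
proof -
  define m where "m = \<lfloor>w\<rfloor>"
  have w': "of_int m + 1/8 \<le> w" "w \<le> of_int m + 3/8"
    using w by (auto simp: m_def frac_def)
  have c': "of_int N + 7/16 \<le> c" "c \<le> of_int N + 9/16"
    using c unfolding abs_le_iff by linarith+
  have "\<lfloor>w + c\<rfloor> = m + N" using w' c' by (intro floor_unique) auto
  then have 0: "step c w = N" by (simp add: step_def m_def)
  have "step c (w + s) = N + 1"
  proof (cases "s \<ge> 0")
    case True
    then have s': "7/16 \<le> s" "s \<le> 9/16"
      using s by linarith+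
    have "\<lfloor>w + s\<rfloor> = m" using w' s' by (intro floor_unique) auto
    moreover have "\<lfloor>w + s + c\<rfloor> = m + N + 1" using w' s' c' by (intro floor_unique) auto
    ultimately show ?thesis by (simp add: step_def)
  next
    case False
    then have s': "- 9/16 \<le> s" "s \<le> - 7/16"
      using s by linarith+
    have "\<lfloor>w + s\<rfloor> = m - 1" using w' s' by (intro floor_unique) auto
    moreover have "\<lfloor>w + s + c\<rfloor> = m + N" using w' s' c' by (intro floor_unique) auto
    ultimately show ?thesis by (simp add: step_def)
  qed
  then show ?thesis using 0 by simp
qed

lemma measurable_sum_int:
  fixes f :: "nat \<Rightarrow> 'a \<Rightarrow> int"
  assumes [measurable]: "\<And>l. f l \<in> M \<rightarrow>\<^sub>M count_space UNIV"
  shows "(\<lambda>x. \<Sum>l<n. f l x) \<in> M \<rightarrow>\<^sub>M count_space UNIV"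
proof (induction n)
  case (Suc n)
  note [measurable] = Suc
  show ?case unfolding sum.lessThan_Suc by measurable
qed simp

text \<open>The denominator 63 comes from the tail of a geometric series of ratio \<open>1/64\<close>; the constants
  leave room for exceptional sets of total measure below \<open>1/8\<close> in \<open>u_sums_unbounded\<close>.\<close>

locale rotation_approximations =
  fixes \<alpha> \<beta> \<gamma> :: real and q b :: "nat \<Rightarrow> nat" and p :: "nat \<Rightarrow> int"
  assumes irrational: "\<alpha> \<notin> \<rat>"
    and beta_bounds: "0 \<le> \<beta>" "\<beta> < 1"
    and q_pos: "\<And>k. q k \<ge> 1"
    and b_pos: "\<And>k. b k \<ge> 1"
    and coprime_pq: "\<And>k. coprime (p k) (int (q k))"
    and b_dvd: "\<And>k. 2 ^ k dvd b k"
    and b_large: "\<And>k. k + (\<Sum>j<k. b j * q j) \<le> b k"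
    and small: "\<And>k. q k * (b k * \<bar>q k * \<alpha> - p k\<bar>) \<le> 1/1000 * (1/2) ^ k"
    and gamma_close: "\<And>k. \<bar>\<gamma> - (\<Sum>j<Suc k. b j * (q j * \<alpha> - p j))\<bar> \<le> \<bar>q k * \<alpha> - p k\<bar> / 63"
    and beta_half: "\<And>k. \<exists>N::int. \<bar>q k * \<beta> - N - 1/2\<bar> \<le> 1/16"
begin

section \<open>Telescoping along the partial sums of \<open>\<gamma>\<close>\<close>

definition \<sigma> :: "nat \<Rightarrow> real" where
  "\<sigma> k = q k * \<alpha> - p k"

definition shift :: "nat \<Rightarrow> real" where
  "shift k = (\<Sum>j<k. b j * \<sigma> j)"

definition transfer :: "nat \<Rightarrow> real \<Rightarrow> int" where
  "transfer k x = (\<Sum>l<b k * q k. step \<beta> (x + shift k + l * \<alpha>))"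

definition u :: "real \<Rightarrow> int" where
  "u x = step \<beta> x - step \<beta> (x + \<gamma>)"

definition radius :: "nat \<Rightarrow> real" where
  "radius k = q k * (b k * \<bar>\<sigma> k\<bar>)"

text \<open>Outside these points \<open>sum_step_periods\<close> evaluates \<open>transfer k\<close>
  as a multiple of \<open>b k\<close>.\<close>

definition bad :: "nat \<Rightarrow> real \<Rightarrow> bool" where
  "bad k x \<longleftrightarrow> near_int (radius k) (q k * (x + shift k)) \<or> near_int (radius k) (q k * (x + shift k + \<beta>))"

lemma sigma_nonzero: "\<sigma> k \<noteq> 0"
  unfolding \<sigma>_def using irrational_combination_nonzero[OF irrational q_pos] .

lemma radius_bounds: "0 \<le> radius k" "radius k \<le> 1/1000 * (1/2) ^ k"
  using small[of k] by (auto simp: radius_def \<sigma>_def)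

lemma sigma_le_radius: "q k * \<bar>\<sigma> k\<bar> \<le> radius k"
  unfolding radius_def using b_pos[of k] by (intro mult_left_mono) (auto simp: mult_le_cancel_right1)

lemma shift_close: "\<bar>\<gamma> - shift (Suc k)\<bar> \<le> \<bar>\<sigma> k\<bar> / 63"
  using gamma_close[of k] by (simp only: shift_def \<sigma>_def)

lemma sigma_tendsto_0: "\<sigma> \<longlonglongrightarrow> 0"
proof -
  have "\<bar>\<sigma> k\<bar> \<le> 1/1000 * (1/2) ^ k" for k
  proof -
    have "\<bar>\<sigma> k\<bar> \<le> q k * \<bar>\<sigma> k\<bar>" using q_pos[of k] by (simp add: mult_le_cancel_right1)
    then show ?thesis using sigma_le_radius[of k] radius_bounds[of k] by linarith
  qed
  moreover have "(\<lambda>k. 1/1000 * (1/2) ^ k :: real) \<longlonglongrightarrow> 0"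
    by (intro tendsto_mult_right_zero LIMSEQ_power_zero) auto
  ultimately show ?thesis
    using Lim_null_comparison[of \<sigma> "\<lambda>k. 1/1000 * (1/2) ^ k" sequentially] by simp
qed

lemma shift_tendsto: "shift \<longlonglongrightarrow> \<gamma>"
proof -
  have "(\<lambda>k. \<gamma> - shift (Suc k)) \<longlonglongrightarrow> 0"
  proof (rule Lim_null_comparison)
    show "\<forall>\<^sub>F k in sequentially. norm (\<gamma> - shift (Suc k)) \<le> \<bar>\<sigma> k\<bar> / 63"
      using shift_close by simp
    have "(\<lambda>k. \<bar>\<sigma> k\<bar> / 63) \<longlonglongrightarrow> \<bar>0\<bar> / 63"
      by (intro tendsto_intros sigma_tendsto_0) auto
    then show "(\<lambda>k. \<bar>\<sigma> k\<bar> / 63) \<longlonglongrightarrow> 0" by simp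
  qed
  then have "(\<lambda>k. \<gamma> - (\<gamma> - shift (Suc k))) \<longlonglongrightarrow> \<gamma> - 0"
    by (intro tendsto_intros)
  then show ?thesis by (subst filterlim_sequentially_Suc[symmetric]) simp
qed

lemma transfer_add_of_int [simp]: "transfer k (x + of_int n) = transfer k x"
proof -
  have "x + of_int n + shift k + l * \<alpha> = x + shift k + l * \<alpha> + of_int n" for l :: nat
    by simp
  then show ?thesis unfolding transfer_def by (simp only: step_add_of_int)
qed

lemma transfer_frac [simp]: "transfer k (frac x) = transfer k x"
  using transfer_add_of_int[of k "frac x" "\<lfloor>x\<rfloor>"] by (simp add: frac_def)

lemma u_frac [simp]: "u (frac x) = u x"
  using step_frac[of \<beta> x 0] step_frac[of \<beta> x \<gamma>] by (simp add: u_def)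

lemma transfer_bounds: "0 \<le> transfer k x" "transfer k x \<le> int (b k * q k)"
proof -
  show "0 \<le> transfer k x"
    unfolding transfer_def by (intro sum_nonneg step_bounds beta_bounds)
  have "transfer k x \<le> (\<Sum>l<b k * q k. 1)"
    unfolding transfer_def by (intro sum_mono step_bounds beta_bounds)
  then show "transfer k x \<le> int (b k * q k)" by simp
qed

lemma transfer_good:
  assumes "\<not> bad k x"
  shows "transfer k x = int (b k) * step (q k * \<beta>) (q k * (x + shift k))"
  unfolding transfer_def
  using assms by (intro sum_step_periods[OF q_pos coprime_pq refl])
    (auto simp: bad_def radius_def \<sigma>_def)

text \<open>The difference of a Birkhoff sum and its rotated copy telescopes to two end terms. Since
  \<open>b k * q k * \<alpha>\<close> equals \<open>b k * \<sigma> k\<close> modulo 1,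
  \<open>b k * q k\<close> steps of the rotation lead from \<open>shift k\<close> to
  \<open>shift (Suc k)\<close>.\<close>

lemma transfer_coboundary:
  "transfer k x - transfer k (x + \<alpha>) = step \<beta> (x + shift k) - step \<beta> (x + shift (Suc k))"
proof -
  define h where "h l = step \<beta> (x + shift k + real l * \<alpha>)" for l
  have "transfer k (x + \<alpha>) = (\<Sum>l<b k * q k. h (Suc l))"
    unfolding transfer_def h_def by (intro sum.cong refl arg_cong[of _ _ "step \<beta>"]) (simp add: algebra_simps)
  then have "transfer k x - transfer k (x + \<alpha>) = (\<Sum>l<b k * q k. h l - h (Suc l))"
    by (simp add: transfer_def h_def sum_subtractf)
  also have "\<dots> = h 0 - h (b k * q k)"
    by (rule sum_lessThan_telescope')
  also have "h (b k * q k) = step \<beta> (x + shift (Suc k))"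
  proof -
    have "x + shift k + real (b k * q k) * \<alpha> = x + shift (Suc k) + of_int (int (b k) * p k)"
      by (simp add: shift_def \<sigma>_def algebra_simps)
    then show ?thesis unfolding h_def by (simp only: step_add_of_int)
  qed
  finally show ?thesis by (simp add: h_def)
qed

text \<open>As \<open>shift\<close> starts at 0, the coboundaries of the levels below
  \<open>k\<close> telescope. The remainder vanishes wherever replacing \<open>shift k\<close> by
  \<open>\<gamma>\<close> crosses no jump of the step.\<close>

lemma u_eq:
  "u x = (\<Sum>j<k. transfer j x - transfer j (x + \<alpha>)) + (step \<beta> (x + shift k) - step \<beta> (x + \<gamma>))"
proof -
  have "(\<Sum>j<k. transfer j x - transfer j (x + \<alpha>)) = step \<beta> (x + shift 0) - step \<beta> (x + shift k)"
    unfolding transfer_coboundary by (rule sum_lessThan_telescope')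
  then show ?thesis by (simp add: u_def shift_def)
qed

lemma sum_u_eq:
  "(\<Sum>l<n. u (x + real l * \<alpha>)) = (\<Sum>j<k. transfer j x - transfer j (x + real n * \<alpha>))
     + (\<Sum>l<n. step \<beta> (x + real l * \<alpha> + shift k) - step \<beta> (x + real l * \<alpha> + \<gamma>))"
proof -
  have "(\<Sum>l<n. \<Sum>j<k. transfer j (x + real l * \<alpha>) - transfer j (x + real l * \<alpha> + \<alpha>)) =
    (\<Sum>j<k. \<Sum>l<n. transfer j (x + real l * \<alpha>) - transfer j (x + real l * \<alpha> + \<alpha>))"
    by (rule sum.swap)
  also have "\<dots> = (\<Sum>j<k. transfer j x - transfer j (x + real n * \<alpha>))"
  proof (intro sum.cong refl)
    fix j
    have eq: "x + l * \<alpha> + \<alpha> = x + real (Suc l) * \<alpha>" for l :: nat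
      by (simp add: algebra_simps)
    have "(\<Sum>l<n. transfer j (x + real l * \<alpha>) - transfer j (x + real l * \<alpha> + \<alpha>)) =
      (\<Sum>l<n. transfer j (x + real l * \<alpha>) - transfer j (x + real (Suc l) * \<alpha>))"
      by (simp only: eq)
    also have "\<dots> = transfer j (x + real 0 * \<alpha>) - transfer j (x + real n * \<alpha>)"
      by (rule sum_lessThan_telescope')
    finally show "(\<Sum>l<n. transfer j (x + real l * \<alpha>) - transfer j (x + real l * \<alpha> + \<alpha>)) =
      transfer j x - transfer j (x + real n * \<alpha>)" by simp
  qed
  finally show ?thesis
    unfolding u_eq[of _ k] sum.distrib by simp
qed

lemma measurable_bad [measurable]: "Measurable.pred borel (bad k)"
  unfolding bad_def by measurable

lemma measurable_transfer [measurable]: "transfer k \<in> borel \<rightarrow>\<^sub>M count_space UNIV"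
  unfolding transfer_def by (intro measurable_sum_int) measurable

lemma measurable_u [measurable]: "u \<in> borel \<rightarrow>\<^sub>M count_space UNIV"
  unfolding u_def by measurable

lemma measure_bad: "measure circle {x \<in> {0..<1}. bad k (x + c)} \<le> 4 * (1/1000 * (1/2) ^ k)"
proof -
  interpret finite_measure circle by (rule finite_measure_circle)
  have "measure circle {x \<in> {0..<1}. bad k (x + c)} \<le>
    measure circle ({x \<in> {0..<1}. near_int (radius k) (real (q k) * x + q k * (c + shift k))} \<union>
      {x \<in> {0..<1}. near_int (radius k) (real (q k) * x + q k * (c + shift k + \<beta>))})"
    by (intro finite_measure_mono) (auto simp: bad_def algebra_simps)
  also have "\<dots> \<le> measure circle {x \<in> {0..<1}. near_int (radius k) (real (q k) * x + q k * (c + shift k))} +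
      measure circle {x \<in> {0..<1}. near_int (radius k) (real (q k) * x + q k * (c + shift k + \<beta>))}"
    by (intro measure_Un_le) auto
  also have "\<dots> \<le> 2 * radius k + 2 * radius k"
    by (intro add_mono measure_near_int_affine q_pos radius_bounds)
  finally show ?thesis using radius_bounds(2)[of k] by linarith
qed

section \<open>Growth of the Birkhoff sums of \<open>u\<close>\<close>

lemma transfer_jump:
  fixes t :: nat
  assumes good: "\<not> bad k x" "\<not> bad k (x + real (t * q k) * \<alpha>)"
    and w: "frac (q k * (x + shift k)) \<in> {1/8..3/8}"
    and t: "\<bar>t * (q k * \<bar>\<sigma> k\<bar>) - 1/2\<bar> \<le> 1/16"
  shows "transfer k (x + real (t * q k) * \<alpha>) = transfer k x + int (b k)"
proof -
  define w0 where "w0 = q k * (x + shift k)"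
  \<comment> \<open>Modulo 1, the time \<open>t * q k\<close> moves \<open>w0\<close> by this
    amount. It is about half a turn in modulus, so \<open>step_half_shift\<close> raises the step by
    one and hence \<open>transfer k\<close> by \<open>b k\<close>.\<close>
  define s where "s = q k * (t * \<sigma> k)"
  obtain N :: int where N: "\<bar>q k * \<beta> - N - 1/2\<bar> \<le> 1/16" using beta_half by blast
  have "q k * (x + real (t * q k) * \<alpha> + shift k) = w0 + s + of_int (int (q k) * int t * p k)"
    by (simp add: w0_def s_def \<sigma>_def algebra_simps)
  then have "transfer k (x + real (t * q k) * \<alpha>) = int (b k) * step (q k * \<beta>) (w0 + s)"
    by (simp only: transfer_good[OF good(2)] step_add_of_int)
  also have "step (q k * \<beta>) (w0 + s) = step (q k * \<beta>) w0 + 1"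
  proof (rule step_half_shift[OF _ N])
    show "frac w0 \<in> {1/8..3/8}" using w by (simp only: w0_def)
    have "\<bar>s\<bar> = t * (q k * \<bar>\<sigma> k\<bar>)" by (simp add: s_def abs_mult)
    then show "\<bar>\<bar>s\<bar> - 1/2\<bar> \<le> 1/16" using t by simp
  qed
  finally show ?thesis
    by (simp add: transfer_good[OF good(1)] w0_def distrib_left)
qed

text \<open>The remainder in \<open>sum_u_eq\<close> vanishes by the last assumption. Level
  \<open>k\<close> contributes \<open>- b k\<close>, and each lower level at most the length of its
  range; \<open>b_large\<close> makes the former win by \<open>k\<close>.\<close>

lemma sum_u_large:
  assumes jump: "transfer k y = transfer k x + int (b k)" and y: "y = x + real n * \<alpha>"
    and same: "\<And>l. l < n \<Longrightarrow> step \<beta> (x + real l * \<alpha> + shift (Suc k)) = step \<beta> (x + real l * \<alpha> + \<gamma>)"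
  shows "int k \<le> \<bar>\<Sum>l<n. u (x + real l * \<alpha>)\<bar>"
proof -
  have "(\<Sum>l<n. u (x + real l * \<alpha>)) = (\<Sum>j<Suc k. transfer j x - transfer j y)"
    unfolding sum_u_eq[where k = "Suc k"] y using same by simp
  also have "\<dots> = (\<Sum>j<k. transfer j x - transfer j y) - int (b k)"
    using jump by simp
  finally have "(\<Sum>l<n. u (x + real l * \<alpha>)) = (\<Sum>j<k. transfer j x - transfer j y) - int (b k)" .
  moreover have "\<bar>\<Sum>j<k. transfer j x - transfer j y\<bar> \<le> (\<Sum>j<k. int (b j * q j))"
  proof (rule order_trans[OF sum_abs sum_mono])
    fix j
    show "\<bar>transfer j x - transfer j y\<bar> \<le> int (b j * q j)"
      using transfer_bounds[of j x] transfer_bounds[of j y] by linarith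
  qed
  moreover have "int k + (\<Sum>j<k. int (b j * q j)) \<le> int (b k)"
    using b_large[of k] by (metis of_nat_add of_nat_le_iff of_nat_sum)
  ultimately show ?thesis by linarith
qed

text \<open>A quarter of the circle, the set \<open>W\<close>, meets the condition on
  \<open>w\<close> in \<open>transfer_jump\<close>. The exceptional sets take away at most
  \<open>1/250 + 1/250 + 4/126\<close>, which is less than 1/8.\<close>

lemma u_sums_unbounded:
  "\<exists>n. 1/8 \<le> measure circle {x \<in> {0..<1}. int k \<le> \<bar>\<Sum>l<n. u (x + real l * \<alpha>)\<bar>}"
proof -
  interpret finite_measure circle by (rule finite_measure_circle)
  define \<theta> where "\<theta> = q k * \<bar>\<sigma> k\<bar>"
  \<comment> \<open>The number of blocks of length \<open>q k\<close> after which the drift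
    \<open>t * \<theta>\<close> has reached a half, up to an error of
    \<open>\<theta>\<close>.\<close>
  define t where "t = nat \<lfloor>1 / (2 * \<theta>)\<rfloor>"
  define n where "n = t * q k"
  define \<rho> where "\<rho> = \<bar>\<gamma> - shift (Suc k)\<bar>"
  have \<theta>: "0 < \<theta>" "\<theta> \<le> 1/1000"
  proof -
    show "0 < \<theta>" unfolding \<theta>_def using q_pos[of k] sigma_nonzero[of k] by simp
    have "(1/2::real) ^ k \<le> 1" by (rule power_le_one) auto
    then show "\<theta> \<le> 1/1000"
      using sigma_le_radius[of k] radius_bounds(2)[of k] unfolding \<theta>_def by linarith
  qed
  have t_le: "t \<le> 1 / (2 * \<theta>)" and t_gt: "1 / (2 * \<theta>) < t + 1"
  proof -
    have "real t = of_int \<lfloor>1 / (2 * \<theta>)\<rfloor>" using \<theta> unfolding t_def by (simp add: of_nat_nat)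
    then show "t \<le> 1 / (2 * \<theta>)" "1 / (2 * \<theta>) < t + 1" by linarith+
  qed
  have t1: "t * \<theta> \<le> 1/2"
    using t_le \<theta> by (simp add: field_simps)
  have "1/2 < t * \<theta> + \<theta>"
    using t_gt \<theta> by (simp add: field_simps)
  then have t: "\<bar>t * (q k * \<bar>\<sigma> k\<bar>) - 1/2\<bar> \<le> 1/16"
    using t1 \<theta> unfolding \<theta>_def by linarith
  \<comment> \<open>\<open>shift_close\<close> gives
    \<open>\<rho> \<le> \<bar>\<sigma> k\<bar> / 63\<close>, and
    \<open>n * \<bar>\<sigma> k\<bar> = t * \<theta>\<close> is at most a half.\<close>
  have n\<rho>: "n * \<rho> \<le> 1/126"
  proof -
    have "n * \<rho> \<le> n * (\<bar>\<sigma> k\<bar> / 63)"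
      unfolding \<rho>_def by (intro mult_left_mono shift_close) simp
    also have "\<dots> = t * \<theta> / 63" by (simp add: n_def \<theta>_def)
    finally show ?thesis using t1 by linarith
  qed
  define T where "T = {x \<in> {0..<1}. int k \<le> \<bar>\<Sum>l<n. u (x + real l * \<alpha>)\<bar>}"
  define W where "W = {x \<in> {0..<1}. frac (real (q k) * x + q k * shift k) \<in> {1/8..3/8}}"
  define B0 where "B0 = {x \<in> {0..<1}. bad k (x + 0)}"
  define B1 where "B1 = {x \<in> {0..<1}. bad k (x + real n * \<alpha>)}"
  \<comment> \<open>The points at which, at time \<open>l\<close>, replacing \<open>\<gamma>\<close>
    by \<open>shift (Suc k)\<close> could cross a jump of the step.\<close>
  define C where "C l = {x \<in> {0..<1}. near_int \<rho> (real 1 * x + (real l * \<alpha> + \<gamma>))} \<union>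
      {x \<in> {0..<1}. near_int \<rho> (real 1 * x + (real l * \<alpha> + \<gamma> + \<beta>))}" for l
  have T_meas: "T \<in> sets circle"
  proof -
    have "(\<lambda>x. \<Sum>l<n. u (x + real l * \<alpha>)) \<in> borel \<rightarrow>\<^sub>M count_space UNIV"
      by (intro measurable_sum_int) measurable
    then have "(\<lambda>x. \<Sum>l<n. u (x + real l * \<alpha>)) -` {z. int k \<le> \<bar>z\<bar>} \<inter> space borel \<in> sets borel"
      by (rule measurable_sets) simp
    then have "(\<lambda>x. \<Sum>l<n. u (x + real l * \<alpha>)) -` {z. int k \<le> \<bar>z\<bar>} \<inter> space borel \<inter> {0..<1} \<in> sets borel"
      by (rule sets.Int) simp
    moreover have "T = (\<lambda>x. \<Sum>l<n. u (x + real l * \<alpha>)) -` {z. int k \<le> \<bar>z\<bar>} \<inter> space borel \<inter> {0..<1}"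
      by (auto simp: T_def)
    ultimately show ?thesis by (simp add: T_def subset_iff)
  qed
  have meas: "B0 \<in> sets circle" "B1 \<in> sets circle" "W \<in> sets circle" "\<And>l. C l \<in> sets circle"
    unfolding B0_def B1_def W_def C_def by auto
  have U: "(\<Union>l<n. C l) \<in> sets circle"
    using meas(4) by (intro sets.finite_UN) auto
  have "W \<subseteq> T \<union> (B0 \<union> (B1 \<union> (\<Union>l<n. C l)))"
  proof
    fix x assume x: "x \<in> W"
    show "x \<in> T \<union> (B0 \<union> (B1 \<union> (\<Union>l<n. C l)))"
    proof (rule ccontr)
      assume no: "x \<notin> T \<union> (B0 \<union> (B1 \<union> (\<Union>l<n. C l)))"
      have x01: "x \<in> {0..<1}" using x by (simp add: W_def)
      have "\<not> bad k x" "\<not> bad k (x + real (t * q k) * \<alpha>)"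
        using no x01 by (auto simp: B0_def B1_def n_def)
      moreover have "frac (q k * (x + shift k)) \<in> {1/8..3/8}"
        using x by (simp add: W_def distrib_left)
      ultimately have jump: "transfer k (x + real n * \<alpha>) = transfer k x + int (b k)"
        unfolding n_def using t by (rule transfer_jump)
      have same: "step \<beta> (x + real l * \<alpha> + shift (Suc k)) = step \<beta> (x + real l * \<alpha> + \<gamma>)" if "l < n" for l
      proof -
        have far: "\<not> near_int \<rho> (x + real l * \<alpha> + \<gamma>)" "\<not> near_int \<rho> (x + real l * \<alpha> + \<gamma> + \<beta>)"
          using no x01 that by (auto simp: C_def add.assoc)
        have "x + real l * \<alpha> + shift (Suc k) = x + real l * \<alpha> + \<gamma> + (shift (Suc k) - \<gamma>)" by simp
        moreover have "\<bar>shift (Suc k) - \<gamma>\<bar> \<le> \<rho>" by (simp add: \<rho>_def abs_minus_commute)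
        ultimately show ?thesis using step_add_eq[OF far] by metis
      qed
      have "int k \<le> \<bar>\<Sum>l<n. u (x + real l * \<alpha>)\<bar>"
        using sum_u_large[OF jump refl same] .
      then show False using no x01 by (simp add: T_def)
    qed
  qed
  then have "measure circle W \<le> measure circle (T \<union> (B0 \<union> (B1 \<union> (\<Union>l<n. C l))))"
    using T_meas meas U by (intro finite_measure_mono sets.Un)
  also have "\<dots> \<le> measure circle T + (measure circle B0 + (measure circle B1 + (\<Sum>l<n. measure circle (C l))))"
  proof -
    have "measure circle (\<Union>l<n. C l) \<le> (\<Sum>l<n. measure circle (C l))"
      using meas(4) by (intro measure_UNION_le) auto
    moreover have "measure circle (B1 \<union> (\<Union>l<n. C l)) \<le> measure circle B1 + measure circle (\<Union>l<n. C l)"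
      using meas U by (intro measure_Un_le)
    moreover have "measure circle (B0 \<union> (B1 \<union> (\<Union>l<n. C l))) \<le>
      measure circle B0 + measure circle (B1 \<union> (\<Union>l<n. C l))"
      using meas U by (intro measure_Un_le sets.Un)
    moreover have "measure circle (T \<union> (B0 \<union> (B1 \<union> (\<Union>l<n. C l)))) \<le>
      measure circle T + measure circle (B0 \<union> (B1 \<union> (\<Union>l<n. C l)))"
      using T_meas meas U by (intro measure_Un_le sets.Un)
    ultimately show ?thesis by linarith
  qed
  also have "\<dots> \<le> measure circle T + (1/250 + (1/250 + n * (4 * \<rho>)))"
  proof -
    have half: "(1/2::real) ^ k \<le> 1" by (rule power_le_one) auto
    have "measure circle B0 \<le> 1/250" "measure circle B1 \<le> 1/250"
      using measure_bad[of k 0] measure_bad[of k "real n * \<alpha>"] half unfolding B0_def B1_def by linarith+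
    moreover have "measure circle (C l) \<le> 4 * \<rho>" for l
    proof -
      have "measure circle (C l) \<le> 2 * \<rho> + 2 * \<rho>"
        unfolding C_def
        by (intro order_trans[OF measure_Un_le] add_mono measure_near_int_affine) (auto simp: \<rho>_def)
      then show ?thesis by simp
    qed
    then have "(\<Sum>l<n. measure circle (C l)) \<le> n * (4 * \<rho>)"
      using sum_bounded_above[of "{..<n}" "\<lambda>l. measure circle (C l)" "4 * \<rho>"] by simp
    ultimately show ?thesis by linarith
  qed
  finally have "measure circle W \<le> measure circle T + (1/250 + (1/250 + n * (4 * \<rho>)))" .
  moreover have "measure circle W = 3/8 - 1/8"
    unfolding W_def by (intro measure_circle_frac_affine q_pos) auto
  ultimately have "1/8 \<le> measure circle T" using n\<rho> by linarith
  then show ?thesis unfolding T_def by blast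
qed

text \<open>A coboundary has tight Birkhoff sums.\<close>

lemma u_not_coboundary:
  fixes g :: "real \<Rightarrow> real"
  assumes g [measurable]: "g \<in> borel_measurable circle"
    and cob: "AE x in circle. of_int (u x) = g x - g (rotation \<alpha> x)"
  shows False
proof -
  interpret finite_measure circle by (rule finite_measure_circle)
  \<comment> \<open>If \<open>\<bar>g x - g y\<bar> \<ge> k\<close>, one of the two values has
    modulus at least \<open>k / 2\<close>. The rotation preserves the measure, so the bound 1/8 of
    \<open>u_sums_unbounded\<close> gives 1/16 for every \<open>A k\<close>, although these sets
    decrease to the empty set.\<close>
  define A where "A k = {x \<in> space circle. real k / 2 \<le> \<bar>g x\<bar>}" for k :: nat
  have A_meas: "A k \<in> sets circle" for k
    unfolding A_def by measurable
  have iter: "rotation (real n * \<alpha>) x = frac (x + real n * \<alpha>)" for n x by (simp add: rotation_def)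
  have sum_eq: "AE x in circle. of_int (\<Sum>l<n. u (x + real l * \<alpha>)) = g x - g (rotation (real n * \<alpha>) x)" for n
  proof (induction n)
    case 0
    show ?case
    proof (rule AE_I2)
      fix x assume "x \<in> space circle"
      then have "frac x = x" by (simp add: frac_eq)
      then show "of_int (\<Sum>l<0. u (x + real l * \<alpha>)) = g x - g (rotation (real 0 * \<alpha>) x)"
        by (simp add: rotation_def)
    qed
  next
    case (Suc n)
    have "AE x in circle. of_int (u (rotation (real n * \<alpha>) x)) =
      g (rotation (real n * \<alpha>) x) - g (rotation \<alpha> (rotation (real n * \<alpha>) x))"
      using AE_circle_rotation[OF cob] .
    moreover have "rotation \<alpha> (rotation (real n * \<alpha>) x) = rotation (real (Suc n) * \<alpha>) x" for x
      by (simp add: rotation_def algebra_simps)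
    moreover have "u (rotation (real n * \<alpha>) x) = u (x + real n * \<alpha>)" for x
      by (simp add: rotation_def)
    ultimately have "AE x in circle. of_int (u (x + real n * \<alpha>)) =
      g (rotation (real n * \<alpha>) x) - g (rotation (real (Suc n) * \<alpha>) x)" by simp
    with Suc show ?case by eventually_elim simp
  qed
  have "1/16 \<le> measure circle (A k)" for k
  proof -
    obtain n where n: "1/8 \<le> measure circle {x \<in> {0..<1}. int k \<le> \<bar>\<Sum>l<n. u (x + real l * \<alpha>)\<bar>}"
      using u_sums_unbounded by blast
    define A' where "A' = rotation (real n * \<alpha>) -` A k \<inter> {0..<1}"
    have A': "A' \<in> sets circle"
      using measurable_sets[OF rotation_measurable A_meas, of "real n * \<alpha>" k] by (simp add: A'_def)
    have "measure circle {x \<in> {0..<1}. int k \<le> \<bar>\<Sum>l<n. u (x + real l * \<alpha>)\<bar>} \<le> measure circle (A k \<union> A')"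
    proof (rule finite_measure_mono_AE)
      show "AE x in circle. x \<in> {x \<in> {0..<1}. int k \<le> \<bar>\<Sum>l<n. u (x + real l * \<alpha>)\<bar>} \<longrightarrow> x \<in> A k \<union> A'"
        using sum_eq[of n]
      proof eventually_elim
        case (elim x)
        show ?case
        proof (rule impI, rule ccontr)
          assume x: "x \<in> {x \<in> {0..<1}. int k \<le> \<bar>\<Sum>l<n. u (x + real l * \<alpha>)\<bar>}" and "x \<notin> A k \<union> A'"
          then have "\<bar>g x\<bar> < real k / 2" "\<bar>g (rotation (real n * \<alpha>) x)\<bar> < real k / 2"
            by (auto simp: A_def A'_def)
          then have "\<bar>real_of_int (\<Sum>l<n. u (x + real l * \<alpha>))\<bar> < real k"
            unfolding elim by linarith
          moreover have "int k \<le> \<bar>\<Sum>l<n. u (x + real l * \<alpha>)\<bar>" using x by simp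
          ultimately show False by linarith
        qed
      qed
    qed (use A' A_meas in auto)
    also have "\<dots> \<le> measure circle (A k) + measure circle A'"
      using A' A_meas by (intro measure_Un_le) auto
    also have "measure circle A' = measure circle (A k)"
      unfolding A'_def by (rule measure_circle_rotation[OF A_meas])
    finally show ?thesis using n by linarith
  qed
  moreover have "(\<lambda>k. measure circle (A k)) \<longlonglongrightarrow> measure circle (\<Inter>k. A k)"
  proof (rule finite_Lim_measure_decseq)
    have "A n \<subseteq> A m" if "m \<le> n" for m n
    proof -
      have "real m / 2 \<le> real n / 2" using that by simp
      then show ?thesis by (auto simp: A_def elim: order_trans)
    qed
    then show "decseq A" by (simp add: decseq_def)
    show "range A \<subseteq> sets circle" using A_meas by blast
  qed
  moreover have "(\<Inter>k. A k) = {}"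
  proof -
    have "\<exists>k. x \<notin> A k" for x
    proof -
      obtain k :: nat where "2 * \<bar>g x\<bar> < k" using reals_Archimedean2 by blast
      then have "x \<notin> A k" by (auto simp: A_def)
      then show ?thesis ..
    qed
    then show ?thesis by auto
  qed
  ultimately have lower: "\<And>k. 1/16 \<le> measure circle (A k)"
    and lim: "(\<lambda>k. measure circle (A k)) \<longlonglongrightarrow> 0" by simp_all
  have "1/16 \<le> (0::real)"
    by (rule LIMSEQ_le_const[OF lim]) (use lower in blast)
  then show False by simp
qed

end

section \<open>The cocycle modulo powers of two\<close>

lemma not_near_int_0_imp:
  assumes "\<not> near_int 0 y"
  shows "\<exists>r>0. \<not> near_int r y"
proof -
  have "0 < frac y" "frac y < 1" using assms unfolding near_int_iff_frac by linarith+
  then show ?thesis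
    by (intro exI[of _ "min (frac y) (1 - frac y) / 2"]) (auto simp: near_int_iff_frac min_def field_simps)
qed

lemma AE_not_near_int_0: "AE x in circle. \<not> near_int 0 (x + c)"
proof (rule AE_I')
  interpret finite_measure circle by (rule finite_measure_circle)
  have "measure circle {x \<in> {0..<1}. near_int 0 (real 1 * x + c)} \<le> 2 * 0"
    by (rule measure_near_int_affine) auto
  then have "measure circle {x \<in> {0..<1}. near_int 0 (x + c)} = 0"
    by (intro antisym) simp_all
  then have "emeasure circle {x \<in> {0..<1}. near_int 0 (x + c)} = 0"
    by (simp add: emeasure_eq_measure)
  then show "{x \<in> {0..<1}. near_int 0 (x + c)} \<in> null_sets circle"
    by (intro null_setsI) auto
qed auto

context rotation_approximations
begin

text \<open>Borel-Cantelli: the bounds in \<open>measure_bad\<close> form a convergent geometric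
  series.\<close>

lemma AE_eventually_good: "AE x in circle. \<forall>\<^sub>F k in sequentially. \<not> bad k x"
proof -
  interpret finite_measure circle by (rule finite_measure_circle)
  define A where "A k = {x \<in> {0..<1}. bad k x}" for k
  have "AE x in circle. \<forall>\<^sub>F k in sequentially. x \<in> space circle - A k"
  proof (rule borel_cantelli_AE1)
    show "A k \<in> sets circle" for k by (auto simp: A_def)
    show "emeasure circle (A k) < \<infinity>" for k
      by (simp add: emeasure_eq_measure)
    show "summable (\<lambda>k. measure circle (A k))"
    proof (rule summable_comparison_test')
      show "summable (\<lambda>k. 4 * (1/1000 * (1/2) ^ k :: real))"
        by (intro summable_mult summable_geometric) simp
      show "norm (measure circle (A k)) \<le> 4 * (1/1000 * (1/2) ^ k)" for k
        using measure_bad[of k 0] by (simp add: A_def)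
    qed
  qed
  then show ?thesis
  proof (rule AE_mp, intro AE_I2 impI)
    fix x assume "x \<in> space circle" "\<forall>\<^sub>F k in sequentially. x \<in> space circle - A k"
    then show "\<forall>\<^sub>F k in sequentially. \<not> bad k x"
      by (auto simp: A_def elim: eventually_mono)
  qed
qed

text \<open>The character of the additive group of reals whose kernel consists of the integer
  multiples of \<open>2 ^ K\<close>; on integers it depends only on the residue modulo
  \<open>2 ^ K\<close>.\<close>

definition character :: "nat \<Rightarrow> real \<Rightarrow> complex" where
  "character K y = cis (2 * pi * y / 2 ^ K)"

lemma character_add: "character K (y + z) = character K y * character K z"
  by (simp add: character_def cis_mult distrib_left add_divide_distrib)

lemma norm_character [simp]: "norm (character K y) = 1"
  by (simp add: character_def)

lemma character_eq_1:
  assumes "2 ^ K dvd (n::int)"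
  shows "character K (of_int n) = 1"
proof -
  obtain m where "n = 2 ^ K * m" using assms by (elim dvdE)
  then have "2 * pi * of_int n / 2 ^ K = of_int m * (2 * pi)" by simp
  then show ?thesis unfolding character_def by (subst cis_eq_1_iff) blast
qed

text \<open>Once \<open>2 ^ K\<close> exceeds \<open>\<bar>y\<bar>\<close>, the only element of the
  kernel this small is 0.\<close>

lemma character_neq_1:
  assumes "y \<noteq> 0"
  shows "\<exists>K. character K y \<noteq> 1"
proof -
  obtain K :: nat where K: "\<bar>y\<bar> < 2 ^ K"
    using real_arch_pow[of 2 "\<bar>y\<bar>"] by auto
  have "character K y \<noteq> 1"
  proof
    assume "character K y = 1"
    then obtain n :: int where "2 * pi * y / 2 ^ K = of_int n * (2 * pi)"
      unfolding character_def by (subst (asm) cis_eq_1_iff) blast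
    then have y: "y = of_int n * 2 ^ K" by (simp add: field_simps)
    then have "\<bar>real_of_int n\<bar> < 1" using K by (simp add: abs_mult)
    then show False using y assms by simp
  qed
  then show ?thesis ..
qed

lemma character_measurable [measurable]: "character K \<in> borel_measurable borel"
proof -
  have "continuous_on UNIV (character K)"
    unfolding character_def by (intro continuous_intros) auto
  then show ?thesis by (rule borel_measurable_continuous_onI)
qed

definition total_transfer :: "nat \<Rightarrow> real \<Rightarrow> int" where
  "total_transfer J x = (\<Sum>j<J. transfer j x)"

text \<open>This stands for the character of the formal sum of all transfer functions. It makes
  sense as soon as the residues of the partial sums modulo \<open>2 ^ K\<close> become constant;
  where the characters fail to converge, the value of \<open>lim\<close> is arbitrary.\<close>

definition limit_character :: "nat \<Rightarrow> real \<Rightarrow> complex" where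
  "limit_character K x = lim (\<lambda>J. character K (of_int (total_transfer J x)))"

lemma limit_character_measurable: "limit_character K \<in> borel_measurable circle"
proof -
  have [measurable]: "total_transfer J \<in> borel \<rightarrow>\<^sub>M count_space UNIV" for J
    unfolding total_transfer_def by (intro measurable_sum_int) measurable
  have "limit_character K \<in> borel_measurable borel"
    unfolding limit_character_def by measurable
  then show ?thesis
    unfolding circle_def by (intro measurable_restrict_space1) simp
qed

text \<open>From index \<open>max J0 K\<close> on, \<open>x\<close> is no longer bad and
  \<open>2 ^ K\<close> divides \<open>b j\<close>, so each further \<open>transfer j x\<close> is a
  multiple of \<open>2 ^ K\<close> and leaves the character unchanged.\<close>

lemma limit_character_eventually:
  assumes "\<forall>\<^sub>F k in sequentially. \<not> bad k x"
  shows "\<forall>\<^sub>F J in sequentially. limit_character K x = character K (of_int (total_transfer J x))"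
proof -
  obtain J0 where J0: "\<And>j. j \<ge> J0 \<Longrightarrow> \<not> bad j x"
    using assms by (auto simp: eventually_sequentially)
  define J1 where "J1 = max J0 K"
  define c where "c = character K (of_int (total_transfer J1 x))"
  have const: "character K (of_int (total_transfer J x)) = c" if "J \<ge> J1" for J
    using that
  proof (induction J rule: dec_induct)
    case (step j)
    have "2 ^ K dvd (2 ^ j :: nat)" using step.hyps by (intro le_imp_power_dvd) (simp add: J1_def)
    then have "2 ^ K dvd b j" using b_dvd dvd_trans by blast
    then have "2 ^ K dvd int (b j)" by (metis of_nat_dvd_iff of_nat_numeral of_nat_power)
    then have "2 ^ K dvd transfer j x"
      using J0[of j] step.hyps by (simp add: transfer_good J1_def)
    then have "character K (of_int (transfer j x)) = 1" by (rule character_eq_1)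
    then show ?case
      using step.IH by (simp add: total_transfer_def character_add)
  qed (simp add: c_def)
  have ev: "\<forall>\<^sub>F J in sequentially. character K (of_int (total_transfer J x)) = c"
    using const unfolding eventually_sequentially by blast
  then have "limit_character K x = c"
    unfolding limit_character_def by (intro limI tendsto_eventually)
  then show ?thesis using ev by (auto elim: eventually_mono)
qed

text \<open>For large \<open>J\<close>, \<open>shift J\<close> is so close to
  \<open>\<gamma>\<close> that the remainder in \<open>u_eq\<close> vanishes at \<open>x\<close>,
  and \<open>u x\<close> is a true difference of values of \<open>total_transfer J\<close>. The
  characters at both points have reached their limits by then.\<close>

lemma limit_character_coboundary:
  assumes good: "\<forall>\<^sub>F k in sequentially. \<not> bad k x"
      "\<forall>\<^sub>F k in sequentially. \<not> bad k (rotation \<alpha> x)"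
    and far: "\<not> near_int 0 (x + \<gamma>)" "\<not> near_int 0 (x + (\<gamma> + \<beta>))"
  shows "limit_character K x = character K (of_int (u x)) * limit_character K (rotation \<alpha> x)"
    "norm (limit_character K x) = 1"
proof -
  obtain r1 r2 where r12: "r1 > 0" "r2 > 0" "\<not> near_int r1 (x + \<gamma>)" "\<not> near_int r2 (x + (\<gamma> + \<beta>))"
    using far not_near_int_0_imp by metis
  define r where "r = min r1 r2"
  have r: "r > 0" "\<not> near_int r (x + \<gamma>)" "\<not> near_int r (x + \<gamma> + \<beta>)"
    using r12 near_int_mono[of r] by (auto simp: r_def add.assoc)
  have "\<forall>\<^sub>F J in sequentially. dist (shift J) \<gamma> < r"
    using shift_tendsto r(1) by (rule tendstoD)
  then have "\<forall>\<^sub>F J in sequentially. step \<beta> (x + shift J) = step \<beta> (x + \<gamma>)"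
  proof eventually_elim
    case (elim J)
    have "step \<beta> (x + \<gamma> + (shift J - \<gamma>)) = step \<beta> (x + \<gamma>)"
      using elim by (intro step_add_eq[OF r(2,3)]) (simp add: dist_real_def)
    then show ?case by simp
  qed
  moreover note limit_character_eventually[OF good(1), of K] limit_character_eventually[OF good(2), of K]
  ultimately have "\<forall>\<^sub>F J in sequentially.
    limit_character K x = character K (of_int (u x)) * limit_character K (rotation \<alpha> x) \<and>
    norm (limit_character K x) = 1"
  proof eventually_elim
    case (elim J)
    have "u x = total_transfer J x - total_transfer J (rotation \<alpha> x)"
      using elim(1) by (simp add: u_eq[of x J] total_transfer_def sum_subtractf rotation_def)
    then have "of_int (total_transfer J x) = real_of_int (u x) + of_int (total_transfer J (rotation \<alpha> x))"
      by simp
    then have "character K (of_int (total_transfer J x)) =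
      character K (of_int (u x)) * character K (of_int (total_transfer J (rotation \<alpha> x)))"
      by (simp only: character_add)
    then show ?case unfolding elim(2,3) by (simp add: norm_mult)
  qed
  then have "limit_character K x = character K (of_int (u x)) * limit_character K (rotation \<alpha> x) \<and>
    norm (limit_character K x) = 1"
    by (rule eventually_const[OF sequentially_bot, THEN iffD1])
  then show "limit_character K x = character K (of_int (u x)) * limit_character K (rotation \<alpha> x)"
    "norm (limit_character K x) = 1" by auto
qed

lemma AE_limit_character:
  "AE x in circle. limit_character K x = character K (of_int (u x)) * limit_character K (rotation \<alpha> x) \<and>
    norm (limit_character K x) = 1"
  using AE_eventually_good AE_circle_rotation[OF AE_eventually_good, of \<alpha>]
    AE_not_near_int_0[of \<gamma>] AE_not_near_int_0[of "\<gamma> + \<beta>"]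
  by eventually_elim (use limit_character_coboundary in blast)

end

section \<open>Consequences of ergodicity and properties of Haar measure\<close>

lemma ergodic_AE_ball:
  fixes F :: "'a \<Rightarrow> complex"
  assumes erg: "ergodic M S" and [measurable]: "F \<in> borel_measurable M"
    and inv: "\<And>x. x \<in> space M \<Longrightarrow> F (S x) = F x" and r: "r > 0"
  shows "\<exists>z. AE x in M. dist (F x) z < r"
proof -
  obtain D :: "complex set" where D: "countable D" "\<And>U. open U \<Longrightarrow> U \<noteq> {} \<Longrightarrow> \<exists>d\<in>D. d \<in> U"
    using countable_dense_exists by blast
  \<comment> \<open>Invariance of \<open>F\<close> makes the preimage of each ball invariant, hence
    null or with null complement.\<close>
  define A where "A d = {x \<in> space M. dist (F x) d < r}" for d
  have A: "A d \<in> sets M" for d unfolding A_def by measurable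
  have "S \<in> measurable M M" using erg by (simp add: ergodic_def)
  then have "S -` A d \<inter> space M = A d" for d
    using inv by (auto simp: A_def dest: measurable_space)
  then have dich: "emeasure M (A d) = 0 \<or> emeasure M (space M - A d) = 0" for d
    using erg A by (simp add: ergodic_def)
  show ?thesis
  proof (cases "\<exists>d. emeasure M (space M - A d) = 0")
    case True
    then obtain d where "emeasure M (space M - A d) = 0" by blast
    then have "space M - A d \<in> null_sets M" using A by (intro null_setsI) auto
    then have "AE x in M. dist (F x) d < r"
      by (rule AE_I') (auto simp: A_def)
    then show ?thesis ..
  next
    case False
    \<comment> \<open>If all preimages are null, those of the balls around the countable dense set
      \<open>D\<close> cover the space; then the measure is zero and any \<open>z\<close> will
      do.\<close>
    then have "A d \<in> null_sets M" for d using dich A by (intro null_setsI) auto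
    then have "AE x in M. \<forall>d\<in>D. x \<notin> A d"
      using D(1) by (intro AE_ball_countable[THEN iffD2] ballI AE_not_in)
    then have "AE x in M. False"
    proof (rule AE_mp, intro AE_I2 impI)
      fix x assume x: "x \<in> space M" "\<forall>d\<in>D. x \<notin> A d"
      obtain d where "d \<in> D" "d \<in> ball (F x) r"
        using D(2)[of "ball (F x) r"] r by auto
      then show False using x by (simp add: A_def)
    qed
    then show ?thesis by (auto elim: AE_mp)
  qed
qed

lemma haar_space:
  assumes "haar_measure_on H \<nu>"
  shows "space \<nu> = H"
  using assms sets_eq_imp_space_eq[of \<nu> "restrict_space borel H"]
  by (simp add: haar_measure_on_def space_restrict_space)

lemma haar_sets:
  assumes "closed_subgroup H" "haar_measure_on H \<nu>"
  shows "A \<in> sets \<nu> \<longleftrightarrow> A \<in> sets borel \<and> A \<subseteq> H"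
  using assms by (auto simp: haar_measure_on_def closed_subgroup_def sets_restrict_space_iff)

text \<open>Intersections of \<open>H\<close> with closed balls are compact, hence of finite
  measure, and they exhaust \<open>H\<close>.\<close>

lemma haar_sigma_finite:
  fixes H :: "(real ^ 'm) set"
  assumes H: "closed_subgroup H" and \<nu>: "haar_measure_on H \<nu>"
  shows "sigma_finite_measure \<nu>"
proof
  define A where "A = range (\<lambda>n::nat. H \<inter> cball 0 (real n))"
  have "A \<subseteq> sets \<nu>"
    using H by (auto simp: A_def haar_sets[OF assms] closed_subgroup_def)
  moreover have "\<Union>A = space \<nu>"
  proof -
    have "\<exists>n. norm x \<le> real n" for x :: "real ^ 'm" by (rule real_arch_simple)
    then show ?thesis by (auto simp: A_def haar_space[OF \<nu>])
  qed
  moreover have "emeasure \<nu> a \<noteq> \<infinity>" if a: "a \<in> A" for a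
  proof -
    obtain n :: nat where "a = H \<inter> cball 0 (real n)" using a unfolding A_def by blast
    moreover have "compact (H \<inter> cball 0 (real n))"
      using H by (intro closed_Int_compact) (auto simp: closed_subgroup_def)
    ultimately show ?thesis using \<nu> unfolding haar_measure_on_def by (metis inf_le1 less_irrefl)
  qed
  ultimately show "\<exists>A. countable A \<and> A \<subseteq> sets \<nu> \<and> \<Union>A = space \<nu> \<and> (\<forall>a\<in>A. emeasure \<nu> a \<noteq> \<infinity>)"
    by (intro exI[of _ A]) (auto simp: A_def)
qed

text \<open>Invariance of \<open>\<nu>\<close> is formulated for images, so the exceptional set of
  the translated property is rewritten as the image of \<open>N\<close> under translation by
  \<open>- h0\<close>.\<close>

lemma AE_haar_translate:
  assumes H: "closed_subgroup H" and \<nu>: "haar_measure_on H \<nu>" and h0: "h0 \<in> H"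
    and P: "AE h in \<nu>. P h"
  shows "AE h in \<nu>. P (h0 + h)"
proof -
  obtain N where N: "N \<in> null_sets \<nu>" "{h \<in> space \<nu>. \<not> P h} \<subseteq> N"
    using P by (auto elim!: AE_E simp: null_sets_def)
  have sub: "N \<in> sets borel" "N \<subseteq> H"
    using N(1) by (auto simp: null_sets_def haar_sets[OF H \<nu>])
  have image: "(\<lambda>x. - h0 + x) ` N = (\<lambda>x. h0 + x) -` N"
  proof (intro set_eqI iffI)
    fix x assume "x \<in> (\<lambda>x. h0 + x) -` N"
    then show "x \<in> (\<lambda>x. - h0 + x) ` N" by (intro image_eqI[of _ _ "h0 + x"]) auto
  qed auto
  have "(\<lambda>x. h0 + x) -` N \<in> sets borel"
    using measurable_sets[OF _ sub(1), of "\<lambda>x. h0 + x" borel] by simp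
  moreover have "(\<lambda>x. - h0 + x) ` N \<subseteq> H"
  proof -
    have "- h0 + x \<in> H" if "x \<in> H" for x
      using H h0 that unfolding closed_subgroup_def by blast
    then show ?thesis using sub(2) by blast
  qed
  moreover have "emeasure \<nu> ((\<lambda>x. - h0 + x) ` N) = 0"
  proof -
    have "\<forall>h\<in>H. \<forall>A\<in>sets \<nu>. emeasure \<nu> ((\<lambda>x. h + x) ` A) = emeasure \<nu> A"
      using \<nu> unfolding haar_measure_on_def by blast
    moreover have "- h0 \<in> H" using H h0 unfolding closed_subgroup_def by blast
    ultimately show ?thesis using N(1) by (metis null_setsD1 null_setsD2)
  qed
  ultimately have "(\<lambda>x. h0 + x) -` N \<in> null_sets \<nu>"
    unfolding image by (intro null_setsI) (auto simp: haar_sets[OF H \<nu>])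
  then show ?thesis
  proof (rule AE_I')
    show "{h \<in> space \<nu>. \<not> P (h0 + h)} \<subseteq> (\<lambda>x. h0 + x) -` N"
      using N(2) H h0 by (auto simp: haar_space[OF \<nu>] closed_subgroup_def)
  qed
qed

section \<open>Non-regularity\<close>

definition alternating_sum :: "real ^ 4 \<Rightarrow> real" where
  "alternating_sum v = v $ 1 - v $ 2 - v $ 3 + v $ 4"

lemma alternating_sum_add: "alternating_sum (v + w) = alternating_sum v + alternating_sum w"
  and alternating_sum_diff: "alternating_sum (v - w) = alternating_sum v - alternating_sum w"
  by (simp_all add: alternating_sum_def)

lemma alternating_sum_measurable [measurable]: "alternating_sum \<in> borel_measurable borel"
proof -
  have "continuous_on UNIV alternating_sum"
    unfolding alternating_sum_def by (intro continuous_intros)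
  then show ?thesis by (rule borel_measurable_continuous_onI)
qed

lemma frac_diff_step: "frac x - frac (x + \<beta>) = of_int (step \<beta> x) - \<beta>"
  by (simp add: step_def frac_def)

context rotation_approximations
begin

text \<open>The choice \<open>\<delta> = \<beta> + \<gamma>\<close> groups the coordinates into two
  differences of fractional parts at distance \<open>\<beta>\<close>; the constants 1/2 and the
  terms \<open>- \<beta>\<close> from \<open>frac_diff_step\<close> cancel.\<close>

lemma alternating_sum_Psi4:
  "alternating_sum (Psi4 \<beta> (frac \<gamma>) (frac (\<beta> + \<gamma>)) x) = of_int (u x)"
proof -
  have "alternating_sum (Psi4 \<beta> (frac \<gamma>) (frac (\<beta> + \<gamma>)) x) =
    (frac x - frac (x + \<beta>)) - (frac (x + \<gamma>) - frac (x + \<gamma> + \<beta>))"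
    by (simp add: alternating_sum_def Psi4_nth sawtooth_def add.assoc add.commute[of \<beta> \<gamma>])
  then show ?thesis by (simp add: frac_diff_step u_def)
qed

theorem not_regular: "\<not> regular_cocycle (rotation \<alpha>) (Psi4 \<beta> (frac \<gamma>) (frac (\<beta> + \<gamma>)))"
proof
  assume "regular_cocycle (rotation \<alpha>) (Psi4 \<beta> (frac \<gamma>) (frac (\<beta> + \<gamma>)))"
  then obtain \<Psi> :: "real \<Rightarrow> real ^ 4" and H \<nu> f where
    H: "closed_subgroup H" and \<Psi>H: "\<And>x. x \<in> space circle \<Longrightarrow> \<Psi> x \<in> H"
    and \<nu>: "haar_measure_on H \<nu>" and erg: "ergodic (circle \<Otimes>\<^sub>M \<nu>) (skew_product (rotation \<alpha>) \<Psi>)"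
    and f [measurable]: "f \<in> borel_measurable circle"
    and cob: "AE x in circle. Psi4 \<beta> (frac \<gamma>) (frac (\<beta> + \<gamma>)) x - \<Psi> x = f x - f (rotation \<alpha> x)"
    unfolding regular_cocycle_def cohomologous_def by blast
  define g where "g x = alternating_sum (f x)" for x
  have g [measurable]: "g \<in> borel_measurable circle"
    unfolding g_def by measurable
  have u_cob: "AE x in circle. of_int (u x) = alternating_sum (\<Psi> x) + (g x - g (rotation \<alpha> x))"
    using cob
  proof eventually_elim
    case (elim x)
    have "alternating_sum (Psi4 \<beta> (frac \<gamma>) (frac (\<beta> + \<gamma>)) x - \<Psi> x) = alternating_sum (f x - f (rotation \<alpha> x))"
      by (simp only: elim)
    then show ?case
      by (simp add: alternating_sum_diff alternating_sum_Psi4 g_def)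
  qed
  \<comment> \<open>Otherwise some character takes a value other than 1 at
    \<open>alternating_sum h0\<close>. Translating \<open>h\<close> by \<open>h0\<close> multiplies
    the invariant function \<open>F\<close> below by this value, although ergodicity makes
    \<open>F\<close> almost constant.\<close>
  have vanish: "alternating_sum h0 = 0" if h0: "h0 \<in> H" for h0
  proof (rule ccontr)
    assume "alternating_sum h0 \<noteq> 0"
    then obtain K where K: "character K (alternating_sum h0) \<noteq> 1"
      using character_neq_1 by blast
    define Q where "Q x \<longleftrightarrow> of_int (u x) = alternating_sum (\<Psi> x) + (g x - g (rotation \<alpha> x)) \<and>
      limit_character K x = character K (of_int (u x)) * limit_character K (rotation \<alpha> x) \<and>
      norm (limit_character K x) = 1" for x
    have "AE x in circle. Q x"
      using u_cob AE_limit_character[of K] unfolding Q_def by eventually_elim blast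
    then obtain N where N: "N \<in> null_sets circle" "{x \<in> space circle. \<not> Q x} \<subseteq> N"
      by (auto elim!: AE_E simp: null_sets_def)
    \<comment> \<open>\<open>ergodic\<close> speaks of sets that are invariant at every point. The
      identities in \<open>Q\<close> hold only almost everywhere, so they are restricted to the
      points whose two-sided orbit avoids \<open>N\<close>, an exactly invariant set.\<close>
    define X where "X = {x \<in> space circle. \<forall>n::int. rotation (n * \<alpha>) x \<notin> N}"
    have rot: "rotation (of_int n * \<alpha>) (rotation \<alpha> x) = rotation (of_int (n + 1) * \<alpha>) x" for n x
      by (simp add: rotation_def algebra_simps)
    have X_inv: "rotation \<alpha> x \<in> X \<longleftrightarrow> x \<in> X" if "x \<in> space circle" for x
    proof -
      have "(\<forall>n::int. rotation (of_int (n + 1) * \<alpha>) x \<notin> N) \<longleftrightarrow> (\<forall>n::int. rotation (n * \<alpha>) x \<notin> N)"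
        by (metis diff_add_cancel)
      then show ?thesis using that by (simp add: X_def rot del: of_int_add)
    qed
    have X_Q: "Q x" if "x \<in> X" for x
    proof -
      have "rotation (of_int 0 * \<alpha>) x \<notin> N" "x \<in> space circle" using that unfolding X_def by blast+
      moreover from this(2) have "rotation (of_int 0 * \<alpha>) x = x" by (simp add: rotation_def frac_eq)
      ultimately show ?thesis using N(2) by auto
    qed
    have [measurable]: "N \<in> sets circle" using N(1) by (rule null_setsD2)
    have X_meas [measurable]: "X \<in> sets circle"
      unfolding X_def by measurable
    have X_AE: "AE x in circle. x \<in> X"
    proof -
      have "AE x in circle. rotation (of_int n * \<alpha>) x \<notin> N" for n
        by (rule AE_circle_rotation[OF AE_not_in[OF N(1)]])
      then have "AE x in circle. \<forall>n::int. rotation (n * \<alpha>) x \<notin> N"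
        by (subst AE_all_countable) blast
      then show ?thesis by (rule AE_mp) (intro AE_I2, simp add: X_def)
    qed
    \<comment> \<open>The skew product adds \<open>\<Psi> x\<close> to \<open>h\<close>. By
      \<open>Q\<close> this changes the first factor by the character of \<open>u x\<close>, which
      the change of \<open>limit_character\<close> compensates; the value 0 outside \<open>X\<close>
      preserves invariance there.\<close>
    define F where "F = (\<lambda>(x, h). if x \<in> X
      then character K (alternating_sum h - g x) * limit_character K x else 0)"
    interpret \<nu>: sigma_finite_measure \<nu> by (rule haar_sigma_finite[OF H \<nu>])
    interpret circle: finite_measure circle by (rule finite_measure_circle)
    interpret pair_sigma_finite circle \<nu> ..
    have [measurable]: "(\<lambda>h. h) \<in> borel_measurable \<nu>"
    proof -
      have "(\<lambda>h. h) \<in> borel_measurable (restrict_space borel H)"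
        by (intro measurable_restrict_space1) simp
      moreover have "sets \<nu> = sets (restrict_space borel H)"
        using \<nu> by (simp add: haar_measure_on_def)
      ultimately show ?thesis by (simp cong: measurable_cong_sets)
    qed
    note [measurable] = limit_character_measurable
    have F_meas: "F \<in> borel_measurable (circle \<Otimes>\<^sub>M \<nu>)"
    proof -
      have [measurable]: "(\<lambda>z. snd z) \<in> borel_measurable (circle \<Otimes>\<^sub>M \<nu>)"
        by (rule measurable_compose[OF measurable_snd]) simp
      show ?thesis unfolding F_def split_beta by measurable
    qed
    have F_inv: "F (skew_product (rotation \<alpha>) \<Psi> z) = F z" if "z \<in> space (circle \<Otimes>\<^sub>M \<nu>)" for z
    proof -
      obtain x h where z: "z = (x, h)" by force
      with that have x: "x \<in> space circle" by (simp add: space_pair_measure)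
      show ?thesis
      proof (cases "x \<in> X")
        case True
        have "alternating_sum (h + \<Psi> x) - g (rotation \<alpha> x) = (alternating_sum h - g x) + of_int (u x)"
          using X_Q[OF True] by (simp add: Q_def alternating_sum_add)
        moreover have "limit_character K x = character K (of_int (u x)) * limit_character K (rotation \<alpha> x)"
          using X_Q[OF True] by (simp add: Q_def)
        ultimately show ?thesis
          using True X_inv[OF x] by (simp add: z F_def skew_product_def character_add)
      next
        case False
        then show ?thesis using X_inv[OF x] by (simp add: z F_def skew_product_def)
      qed
    qed
    \<comment> \<open>Half of the distance by which translation by \<open>h0\<close> moves a value
      of modulus 1: two values within \<open>r\<close> of \<open>z\<close> are closer than
      \<open>2 * r\<close>, but \<open>F (x, h0 + h)\<close> and \<open>F (x, h)\<close> are exactly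
      \<open>2 * r\<close> apart.\<close>
    define r where "r = norm (character K (alternating_sum h0) - 1) / 2"
    have "r > 0" using K by (simp add: r_def)
    then have "\<exists>z. AE y in circle \<Otimes>\<^sub>M \<nu>. dist (F y) z < r"
      using ergodic_AE_ball[where M = "circle \<Otimes>\<^sub>M \<nu>" and F = F and S = "skew_product (rotation \<alpha>) \<Psi>"]
        erg F_meas F_inv by simp
    then obtain z where AE_F: "AE y in circle \<Otimes>\<^sub>M \<nu>. dist (F y) z < r" ..
    \<comment> \<open>By Fubini's theorem a single fibre over a point of \<open>X\<close> can be
      fixed, in which Haar measure allows the translation by \<open>h0\<close>.\<close>
    from AE_pair[OF AE_F] have "AE x in circle. AE h in \<nu>. dist (F (x, h)) z < r" .
    with X_AE have AE_both: "AE x in circle. x \<in> X \<and> (AE h in \<nu>. dist (F (x, h)) z < r)"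
      by (rule AE_conjI)
    have not_null: "\<not> (AE x in circle. False)"
      using emeasure_space_circle by (simp add: eventually_False ae_filter_eq_bot_iff)
    obtain x where x: "x \<in> X" "AE h in \<nu>. dist (F (x, h)) z < r"
    proof (rule ccontr)
      assume "\<not> thesis"
      then have none: "\<not> (x \<in> X \<and> (AE h in \<nu>. dist (F (x, h)) z < r))" for x
        using that by blast
      have "AE x in circle. False" using AE_both by (rule AE_mp) (use none in \<open>intro AE_I2 impI, blast\<close>)
      then show False using not_null by blast
    qed
    have "AE h in \<nu>. dist (F (x, h0 + h)) z < r"
      by (rule AE_haar_translate[OF H \<nu> h0 x(2)])
    with x(2) have "AE h in \<nu>. False"
    proof eventually_elim
      case (elim h)
      have "F (x, h0 + h) = character K (alternating_sum h0) * F (x, h)"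
        using x(1) by (simp add: F_def alternating_sum_add character_add[symmetric] add_diff_eq flip: mult.assoc)
      then have "F (x, h0 + h) - F (x, h) = (character K (alternating_sum h0) - 1) * F (x, h)"
        by (simp add: left_diff_distrib)
      moreover have "norm (F (x, h)) = 1"
      proof -
        have "norm (limit_character K x) = 1" using X_Q[OF x(1)] unfolding Q_def by blast
        then show ?thesis using x(1) by (simp add: F_def norm_mult)
      qed
      ultimately have "dist (F (x, h0 + h)) (F (x, h)) = 2 * r"
        by (simp add: dist_norm norm_mult r_def)
      then show False
        using elim dist_triangle2[of "F (x, h0 + h)" "F (x, h)" z] by linarith
    qed
    moreover have "emeasure \<nu> (space \<nu>) \<noteq> 0"
      using \<nu> by (simp add: haar_space[OF \<nu>] haar_measure_on_def)
    ultimately show False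
      by (simp add: eventually_False ae_filter_eq_bot_iff)
  qed
  \<comment> \<open>The values of \<open>\<Psi>\<close> lie in \<open>H\<close>, where the
    alternating sum is zero, so only the coboundary of \<open>g\<close> is left.\<close>
  have "AE x in circle. of_int (u x) = g x - g (rotation \<alpha> x)"
    using u_cob by (rule AE_mp) (intro AE_I2, simp add: vanish \<Psi>H)
  with g show False by (rule u_not_coboundary)
qed

end

section \<open>Choice of the parameters\<close>

text \<open>The multiplicity \<open>b\<close> depends only on \<open>k\<close> and \<open>B\<close>
  and is fixed first; \<open>q\<close> and \<open>p\<close> are then chosen with tolerance
  \<open>e / b\<close>, which absorbs the factor \<open>b\<close>.\<close>

lemma next_approximation:
  fixes \<alpha> c :: real
  assumes \<alpha>: "\<alpha> \<notin> \<rat>" "0 < \<alpha>" "\<alpha> < 1" "\<not> bounded_type \<alpha>" and c: "c > 0"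
  shows "\<exists>(q::nat) (p::int) (b::nat). q \<ge> N \<and> q \<ge> 1 \<and> coprime p (int q) \<and> b \<ge> 1 \<and> (2::nat) ^ k dvd b \<and>
    k + B \<le> b \<and> q * (b * \<bar>q * \<alpha> - p\<bar>) \<le> 1/1000 * (1/2) ^ k \<and> b * \<bar>q * \<alpha> - p\<bar> \<le> c"
proof -
  define b where "b = (2::nat) ^ k * (k + B + 1)"
  define e where "e = min (1/1000 * (1/2) ^ k) c"
  have b: "b \<ge> 1" "k + B \<le> b" "(2::nat) ^ k dvd b"
  proof -
    have "1 * (k + B + 1) \<le> b" unfolding b_def by (intro mult_right_mono) auto
    then show "b \<ge> 1" "k + B \<le> b" by auto
  qed (simp add: b_def)
  have "e > 0" using c by (simp add: e_def)
  then have "e / b > 0" using b(1) by simp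
  then obtain q :: nat and p :: int where q: "q \<ge> N" "q \<ge> 1" "coprime p (int q)" "q * \<bar>q * \<alpha> - p\<bar> \<le> e / b"
    using well_approximable_large[OF \<alpha>, of "e / b" N] by blast
  have le: "q * (b * \<bar>q * \<alpha> - p\<bar>) \<le> e"
    using q(4) b(1) by (simp add: pos_le_divide_eq mult.assoc mult.left_commute mult.commute)
  have "b * \<bar>q * \<alpha> - p\<bar> \<le> q * (b * \<bar>q * \<alpha> - p\<bar>)"
    using mult_right_mono[of 1 "real q" "b * \<bar>q * \<alpha> - p\<bar>"] q(2) by simp
  then have "b * \<bar>q * \<alpha> - p\<bar> \<le> e" using le by linarith
  moreover have "e \<le> 1/1000 * (1/2) ^ k" "e \<le> c" by (simp_all add: e_def)
  ultimately show ?thesis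
    using q b le by (intro exI[of _ q] exI[of _ p] exI[of _ b]) auto
qed

text \<open>Dependent choice sees only the previous stage, but the size required of
  \<open>b k\<close> depends on all earlier ones. A fourth component \<open>B\<close> therefore
  carries the sum of the \<open>b j * q j\<close> up to the present index.\<close>

lemma approximation_sequence:
  fixes \<alpha> :: real
  assumes \<alpha>: "\<alpha> \<notin> \<rat>" "0 < \<alpha>" "\<alpha> < 1" "\<not> bounded_type \<alpha>"
  obtains q b :: "nat \<Rightarrow> nat" and p :: "nat \<Rightarrow> int" where
    "\<And>k. q k \<ge> 1" "\<And>k. b k \<ge> 1" "\<And>k. coprime (p k) (int (q k))" "\<And>k. (2::nat) ^ k dvd b k"
    "\<And>k. k + (\<Sum>j<k. b j * q j) \<le> b k"
    "\<And>k. q k * (b k * \<bar>q k * \<alpha> - p k\<bar>) \<le> 1/1000 * (1/2) ^ k"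
    "\<And>k. b (Suc k) * \<bar>q (Suc k) * \<alpha> - p (Suc k)\<bar> \<le> \<bar>q k * \<alpha> - p k\<bar> / 64"
    "\<And>k. q (Suc k) \<ge> 64 * q k"
proof -
  define P :: "nat \<Rightarrow> nat \<times> int \<times> nat \<times> nat \<Rightarrow> bool" where
    "P k = (\<lambda>(q, p, b, B). q \<ge> 1 \<and> coprime p (int q) \<and> b \<ge> 1 \<and> (2::nat) ^ k dvd b \<and>
      q * (b * \<bar>q * \<alpha> - p\<bar>) \<le> 1/1000 * (1/2) ^ k \<and> (k = 0 \<longrightarrow> (b * q :: nat) = B))" for k
  \<comment> \<open>\<open>P\<close> sets \<open>B\<close> at index 0 and \<open>Q\<close> updates
    it. As \<open>B\<close> includes the term of index \<open>k\<close>, the first clause is the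
    condition on \<open>b (Suc k)\<close> with the sum over \<open>j < Suc k\<close>.\<close>
  define Q :: "nat \<Rightarrow> nat \<times> int \<times> nat \<times> nat \<Rightarrow> nat \<times> int \<times> nat \<times> nat \<Rightarrow> bool" where
    "Q k = (\<lambda>(q, p, b, B) (q', p', b', B'). (Suc k + B :: nat) \<le> b' \<and> (B + b' * q' :: nat) = B' \<and>
      b' * \<bar>q' * \<alpha> - p'\<bar> \<le> \<bar>q * \<alpha> - p\<bar> / 64 \<and> (64 * q :: nat) \<le> q')" for k
  have "\<exists>f. \<forall>n. P n (f n) \<and> Q n (f n) (f (Suc n))"
  proof (rule dependent_nat_choice)
    obtain q :: nat and p :: int and b :: nat where
      "q \<ge> 1" "coprime p (int q)" "b \<ge> 1" "q * (b * \<bar>q * \<alpha> - p\<bar>) \<le> 1/1000 * (1/2) ^ 0"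
      using next_approximation[OF \<alpha>, of 1 0 0 0] by auto
    then have "P 0 (q, p, b, b * q)" by (simp add: P_def)
    then show "\<exists>x. P 0 x" ..
  next
    fix x k assume "P k x"
    moreover obtain q p b B where x: "x = (q, p, b, B)" by (cases x)
    ultimately have "\<bar>q * \<alpha> - p\<bar> / 64 > 0"
      using irrational_combination_nonzero[OF \<alpha>(1), of q p] by (simp add: P_def)
    from next_approximation[OF \<alpha> this, of "64 * q" "Suc k" B]
    obtain q' :: nat and p' :: int and b' :: nat where
      "q' \<ge> 64 * q" "q' \<ge> 1" "coprime p' (int q')" "b' \<ge> 1" "(2::nat) ^ Suc k dvd b'" "Suc k + B \<le> b'"
      "q' * (b' * \<bar>q' * \<alpha> - p'\<bar>) \<le> 1/1000 * (1/2) ^ Suc k" "b' * \<bar>q' * \<alpha> - p'\<bar> \<le> \<bar>q * \<alpha> - p\<bar> / 64"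
      by blast
    then have "P (Suc k) (q', p', b', B + b' * q') \<and> Q k x (q', p', b', B + b' * q')"
      by (simp add: P_def Q_def x)
    then show "\<exists>y. P (Suc k) y \<and> Q k x y" ..
  qed
  then obtain f where f: "\<And>n. P n (f n)" "\<And>n. Q n (f n) (f (Suc n))" by blast
  define q where "q k = fst (f k)" for k
  define p where "p k = fst (snd (f k))" for k
  define b where "b k = fst (snd (snd (f k)))" for k
  define B where "B k = snd (snd (snd (f k)))" for k
  have fk: "f k = (q k, p k, b k, B k)" for k
    by (simp add: q_def p_def b_def B_def)
  have P: "q k \<ge> 1" "coprime (p k) (int (q k))" "b k \<ge> 1" "(2::nat) ^ k dvd b k"
    "q k * (b k * \<bar>q k * \<alpha> - p k\<bar>) \<le> 1/1000 * (1/2) ^ k" "k = 0 \<Longrightarrow> b k * q k = B k" for k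
    using f(1)[of k] by (simp_all add: P_def fk)
  have Q: "Suc k + B k \<le> b (Suc k)" "B k + b (Suc k) * q (Suc k) = B (Suc k)"
    "b (Suc k) * \<bar>q (Suc k) * \<alpha> - p (Suc k)\<bar> \<le> \<bar>q k * \<alpha> - p k\<bar> / 64" "q (Suc k) \<ge> 64 * q k" for k
    using f(2)[of k] by (simp_all add: Q_def fk)
  have B: "B k = (\<Sum>j<Suc k. b j * q j)" for k
    by (induction k) (simp_all add: P(6)[symmetric] Q(2)[symmetric])
  have large: "k + (\<Sum>j<k. b j * q j) \<le> b k" for k
    by (cases k) (use Q(1) B in auto)
  show ?thesis
    by (rule that[OF P(1) P(3) P(2) P(4) large P(5) Q(3) Q(4)])
qed

text \<open>Comparison with the geometric series of ratio 1/64, whose sum is 64/63.\<close>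

lemma geometric_tail:
  fixes a :: "nat \<Rightarrow> real"
  assumes nonneg: "\<And>k. 0 \<le> a k" and decay: "\<And>k. a (Suc k) \<le> a k / 64"
  shows "summable a" "(\<Sum>j. a (j + k)) \<le> 64/63 * a k"
proof -
  have bound: "a (j + k) \<le> a k * (1/64) ^ j" for j k
  proof (induction j)
    case (Suc j)
    then show ?case using decay[of "j + k"] by simp
  qed simp
  have geo: "(\<lambda>j. a k * (1/64) ^ j) sums (a k * (64/63))" for k
    using sums_mult[OF geometric_sums[of "1/64::real"], of "a k"] by simp
  show "summable a"
    by (rule summable_comparison_test'[OF sums_summable[OF geo[of 0]]]) (use bound[of _ 0] nonneg in simp)
  then have "summable (\<lambda>j. a (j + k))" by (simp add: summable_iff_shift)
  then have "(\<Sum>j. a (j + k)) \<le> (\<Sum>j. a k * (1/64) ^ j)"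
    using bound by (intro suminf_le sums_summable[OF geo]) auto
  also have "\<dots> = 64/63 * a k" using sums_unique[OF geo[of k]] by simp
  finally show "(\<Sum>j. a (j + k)) \<le> 64/63 * a k" .
qed

lemma rapid_series_limit:
  fixes s d :: "nat \<Rightarrow> real"
  assumes decay: "\<And>k. d (Suc k) \<le> d k / 64" and s: "\<And>k. \<bar>s k\<bar> \<le> d k"
  shows "\<bar>(\<Sum>j. s j) - (\<Sum>j<k. s j)\<bar> \<le> 64/63 * d k"
proof -
  have nonneg: "0 \<le> d k" for k using s[of k] by linarith
  note tail = geometric_tail[of d, OF nonneg decay]
  have abs: "summable (\<lambda>j. \<bar>s j\<bar>)"
    by (rule summable_comparison_test'[OF tail(1)]) (use s in simp)
  then have sum: "summable s" by (rule summable_rabs_cancel)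
  have "(\<Sum>j. s j) - (\<Sum>j<k. s j) = (\<Sum>j. s (j + k))"
    using suminf_minus_initial_segment[OF sum, of k] by simp
  also have "\<bar>\<dots>\<bar> \<le> (\<Sum>j. \<bar>s (j + k)\<bar>)"
    using abs by (intro summable_rabs) (simp add: summable_iff_shift[of "\<lambda>j. \<bar>s j\<bar>"])
  also have "\<dots> \<le> (\<Sum>j. d (j + k))"
    using s abs tail(1)
    by (intro suminf_le) (simp_all add: summable_iff_shift summable_iff_shift[of "\<lambda>j. \<bar>s j\<bar>"])
  also have "\<dots> \<le> 64/63 * d k" by (rule tail(2))
  finally show ?thesis .
qed

text \<open>Greedy construction: stage \<open>k\<close> adds a number below \<open>1 / q k\<close>
  that makes \<open>q k\<close> times the partial sum a half modulo 1. Since \<open>q\<close> grows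
  at least by the factor 64, all later stages together change this product by at most 1/63.\<close>

lemma half_integer_multiples:
  fixes q :: "nat \<Rightarrow> nat"
  assumes q: "\<And>k. q k \<ge> 1" "\<And>k. q (Suc k) \<ge> 64 * q k"
  obtains \<beta> :: real where "0 \<le> \<beta>" "\<beta> < 1" "\<And>k. \<exists>N::int. \<bar>q k * \<beta> - N - 1/2\<bar> \<le> 1/16"
proof -
  define s where "s = rec_nat 0 (\<lambda>k x. x + frac (1/2 - q k * x) / q k)"
  define c where "c k = frac (1/2 - q k * s k) / q k" for k
  have s: "s k = (\<Sum>j<k. c j)" for k
    by (induction k) (simp_all add: s_def c_def)
  define \<beta>0 where "\<beta>0 = (\<Sum>j. c j)"
  have q0: "0 < real (q k)" for k using q(1)[of k] by simp
  have inv: "1 / q (Suc k) \<le> 1 / q k / 64" for k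
  proof -
    have "64 * real (q k) \<le> q (Suc k)" using q(2)[of k] by linarith
    then show ?thesis using q0[of k] q0[of "Suc k"] by (simp add: field_simps)
  qed
  have c: "\<bar>c k\<bar> \<le> 1 / q k" for k
    using q0[of k] frac_lt_1[of "1/2 - q k * s k"] by (simp add: c_def divide_right_mono less_imp_le)
  have close: "\<bar>\<beta>0 - s k\<bar> \<le> 64/63 * (1 / q k)" for k
    unfolding \<beta>0_def s by (rule rapid_series_limit[of "\<lambda>k. 1 / q k", OF inv c])
  have "\<exists>N::int. \<bar>q k * frac \<beta>0 - N - 1/2\<bar> \<le> 1/16" for k
  proof -
    define m where "m = \<lfloor>1/2 - q k * s k\<rfloor>"
    have "s (Suc k) = s k + frac (1/2 - q k * s k) / q k"
      using s[of k] s[of "Suc k"] by (simp add: c_def[of k])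
    then have "q k * s (Suc k) = q k * s k + frac (1/2 - q k * s k)"
      using q0[of k] by (simp add: field_simps)
    then have half: "q k * s (Suc k) = 1/2 - of_int m"
      by (simp add: frac_def m_def)
    have "\<bar>q k * \<beta>0 - q k * s (Suc k)\<bar> = q k * \<bar>\<beta>0 - s (Suc k)\<bar>"
      by (simp add: abs_mult flip: right_diff_distrib)
    also have "\<dots> \<le> q k * (64/63 * (1 / q k / 64))"
      using close[of "Suc k"] inv[of k] by (intro mult_left_mono) auto
    also have "\<dots> \<le> 1/16" using q0[of k] by simp
    finally have "\<bar>q k * \<beta>0 - of_int (- m) - 1/2\<bar> \<le> 1/16"
      unfolding half of_int_minus by linarith
    moreover have "q k * frac \<beta>0 = q k * \<beta>0 - of_int (int (q k) * \<lfloor>\<beta>0\<rfloor>)"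
      by (simp add: frac_def right_diff_distrib)
    ultimately have "\<bar>q k * frac \<beta>0 - of_int (- m - int (q k) * \<lfloor>\<beta>0\<rfloor>) - 1/2\<bar> \<le> 1/16"
      by simp
    then show ?thesis ..
  qed
  then show ?thesis using that[of "frac \<beta>0"] by (simp add: frac_lt_1)
qed

lemma exists_rotation_approximations:
  fixes \<alpha> :: real
  assumes \<alpha>: "\<alpha> \<notin> \<rat>" "0 < \<alpha>" "\<alpha> < 1" "\<not> bounded_type \<alpha>"
  shows "\<exists>\<beta> \<gamma> q b p. rotation_approximations \<alpha> \<beta> \<gamma> q b p"
proof -
  obtain q b :: "nat \<Rightarrow> nat" and p :: "nat \<Rightarrow> int" where
    q: "\<And>k. q k \<ge> 1" and b: "\<And>k. b k \<ge> 1" and "\<And>k. coprime (p k) (int (q k))" "\<And>k. (2::nat) ^ k dvd b k"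
    "\<And>k. k + (\<Sum>j<k. b j * q j) \<le> b k"
    "\<And>k. q k * (b k * \<bar>q k * \<alpha> - p k\<bar>) \<le> 1/1000 * (1/2) ^ k"
    and decay: "\<And>k. b (Suc k) * \<bar>q (Suc k) * \<alpha> - p (Suc k)\<bar> \<le> \<bar>q k * \<alpha> - p k\<bar> / 64"
    and growth: "\<And>k. q (Suc k) \<ge> 64 * q k"
    using approximation_sequence[OF \<alpha>] by blast
  moreover obtain \<beta> :: real where "0 \<le> \<beta>" "\<beta> < 1" "\<And>k. \<exists>N::int. \<bar>q k * \<beta> - N - 1/2\<bar> \<le> 1/16"
    using half_integer_multiples[of q, OF q growth] by blast
  moreover define \<gamma> where "\<gamma> = (\<Sum>j. b j * (q j * \<alpha> - p j))"
  have "\<bar>\<gamma> - (\<Sum>j<Suc k. b j * (q j * \<alpha> - p j))\<bar> \<le> \<bar>q k * \<alpha> - p k\<bar> / 63" for k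
  proof -
    \<comment> \<open>\<open>decay\<close> bounds \<open>d (Suc k)\<close> by a 64th of the error at
      level \<open>k\<close>, which is at most \<open>d k / 64\<close> because
      \<open>b k \<ge> 1\<close>. The factor 64/63 of the tail and the 64th combine to the
      denominator 63 of the claim.\<close>
    define d where "d k = b k * \<bar>q k * \<alpha> - p k\<bar>" for k
    have "d (Suc k) \<le> d k / 64" for k
    proof -
      have "\<bar>q k * \<alpha> - p k\<bar> / 64 \<le> d k / 64"
        unfolding d_def using mult_right_mono[of 1 "real (b k)" "\<bar>q k * \<alpha> - p k\<bar>"] b[of k] by simp
      then show ?thesis using decay[of k] unfolding d_def by (rule order_trans[rotated])
    qed
    then have "\<bar>\<gamma> - (\<Sum>j<Suc k. b j * (q j * \<alpha> - p j))\<bar> \<le> 64/63 * d (Suc k)"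
      unfolding \<gamma>_def by (rule rapid_series_limit) (simp add: d_def abs_mult)
    then show ?thesis using decay[of k] unfolding d_def by linarith
  qed
  ultimately have "rotation_approximations \<alpha> \<beta> \<gamma> q b p"
    using \<alpha>(1) by unfold_locales
  then show ?thesis by blast
qed

theorem theorem4p3:
  fixes \<alpha> :: real
  assumes "0 < \<alpha>" and "\<alpha> < 1" and "\<alpha> \<notin> \<rat>" and "\<not> bounded_type \<alpha>"
  shows "\<exists>\<beta>\<in>{0..<1}. \<exists>\<gamma>\<in>{0..<1}. \<exists>\<delta>\<in>{0..<1}.
           \<not> regular_cocycle (rotation \<alpha>) (Psi4 \<beta> \<gamma> \<delta>)"
proof -
  obtain \<beta> \<gamma> q b p where "rotation_approximations \<alpha> \<beta> \<gamma> q b p"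
    using exists_rotation_approximations[OF assms(3,1,2,4)] by blast
  then interpret rotation_approximations \<alpha> \<beta> \<gamma> q b p .
  have "\<beta> \<in> {0..<1}" "frac \<gamma> \<in> {0..<1}" "frac (\<beta> + \<gamma>) \<in> {0..<1}"
    using beta_bounds by (simp_all add: frac_lt_1)
  then show ?thesis using not_regular by blast
qed

end
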